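(* There is a model $M$ of Peano arithmetic (in the language $\{0,1,+,\cdot,<\}$) in which the standard part $\{0,1,2,\dots\}$ is implicitly definable: there is an $L\cup\{P\}$-sentence $\varphi(P)$ with parameters from $M$ such that the standard part is the unique subset $B\subseteq M$ with $(M,B)\models\varphi(B)$.
   Context: $L=\{0,1,+,\cdot,<\}$ and $P$ is a new unary predicate symbol (second-order variable) not in $L$. *)

theory Defs
  imports Main
begin

text \<open>
  Syntax of \<open>L \<union> {P}\<close>, \<open>L = {0, 1, +, \<cdot>, <}\<close>, with a constant \<open>Par a\<close> for each possible
  parameter \<open>a\<close>. Variables are de Bruijn indices.
\<close>

datatype 'a trm =
    Var nat
  | Par 'a
  | Zero
  | One
  | Add "'a trm" "'a trm"
  | Mul "'a trm" "'a trm"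

datatype 'a fm =
    Eq "'a trm" "'a trm"
  | Less "'a trm" "'a trm"
  | InP "'a trm"
  | Neg "'a fm"
  | Conj "'a fm" "'a fm"
  | Forall "'a fm"

abbreviation Imp :: "'a fm \<Rightarrow> 'a fm \<Rightarrow> 'a fm" where
  "Imp \<phi> \<psi> \<equiv> Neg (Conj \<phi> (Neg \<psi>))"

abbreviation Iff :: "'a fm \<Rightarrow> 'a fm \<Rightarrow> 'a fm" where
  "Iff \<phi> \<psi> \<equiv> Conj (Imp \<phi> \<psi>) (Imp \<psi> \<phi>)"

abbreviation Exists :: "'a fm \<Rightarrow> 'a fm" where
  "Exists \<phi> \<equiv> Neg (Forall (Neg \<phi>))"

text \<open>The parameters of a formula are the elements of \<open>set_fm \<phi>\<close>.\<close>

primrec closed_trm :: "nat \<Rightarrow> 'a trm \<Rightarrow> bool" where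
  "closed_trm n (Var i) \<longleftrightarrow> i < n"
| "closed_trm n (Par a) \<longleftrightarrow> True"
| "closed_trm n Zero \<longleftrightarrow> True"
| "closed_trm n One \<longleftrightarrow> True"
| "closed_trm n (Add s t) \<longleftrightarrow> closed_trm n s \<and> closed_trm n t"
| "closed_trm n (Mul s t) \<longleftrightarrow> closed_trm n s \<and> closed_trm n t"

primrec closed_fm :: "nat \<Rightarrow> 'a fm \<Rightarrow> bool" where
  "closed_fm n (Eq s t) \<longleftrightarrow> closed_trm n s \<and> closed_trm n t"
| "closed_fm n (Less s t) \<longleftrightarrow> closed_trm n s \<and> closed_trm n t"
| "closed_fm n (InP t) \<longleftrightarrow> closed_trm n t"
| "closed_fm n (Neg \<phi>) \<longleftrightarrow> closed_fm n \<phi>"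
| "closed_fm n (Conj \<phi> \<psi>) \<longleftrightarrow> closed_fm n \<phi> \<and> closed_fm n \<psi>"
| "closed_fm n (Forall \<phi>) \<longleftrightarrow> closed_fm (Suc n) \<phi>"

definition sentence :: "'a fm \<Rightarrow> bool" where
  "sentence \<phi> \<longleftrightarrow> closed_fm 0 \<phi>"

primrec P_free :: "'a fm \<Rightarrow> bool" where
  "P_free (Eq s t) \<longleftrightarrow> True"
| "P_free (Less s t) \<longleftrightarrow> True"
| "P_free (InP t) \<longleftrightarrow> False"
| "P_free (Neg \<phi>) \<longleftrightarrow> P_free \<phi>"
| "P_free (Conj \<phi> \<psi>) \<longleftrightarrow> P_free \<phi> \<and> P_free \<psi>"
| "P_free (Forall \<phi>) \<longleftrightarrow> P_free \<phi>"

definition L_formula :: "'a fm \<Rightarrow> bool" where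
  "L_formula \<phi> \<longleftrightarrow> P_free \<phi> \<and> set_fm \<phi> = {}"

primrec subst_trm :: "(nat \<Rightarrow> 'a trm) \<Rightarrow> 'a trm \<Rightarrow> 'a trm" where
  "subst_trm \<sigma> (Var i) = \<sigma> i"
| "subst_trm \<sigma> (Par a) = Par a"
| "subst_trm \<sigma> Zero = Zero"
| "subst_trm \<sigma> One = One"
| "subst_trm \<sigma> (Add s t) = Add (subst_trm \<sigma> s) (subst_trm \<sigma> t)"
| "subst_trm \<sigma> (Mul s t) = Mul (subst_trm \<sigma> s) (subst_trm \<sigma> t)"

definition lift_subst :: "(nat \<Rightarrow> 'a trm) \<Rightarrow> nat \<Rightarrow> 'a trm" where
  "lift_subst \<sigma> = case_nat (Var 0) (\<lambda>i. subst_trm (\<lambda>j. Var (Suc j)) (\<sigma> i))"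

primrec subst_fm :: "(nat \<Rightarrow> 'a trm) \<Rightarrow> 'a fm \<Rightarrow> 'a fm" where
  "subst_fm \<sigma> (Eq s t) = Eq (subst_trm \<sigma> s) (subst_trm \<sigma> t)"
| "subst_fm \<sigma> (Less s t) = Less (subst_trm \<sigma> s) (subst_trm \<sigma> t)"
| "subst_fm \<sigma> (InP t) = InP (subst_trm \<sigma> t)"
| "subst_fm \<sigma> (Neg \<phi>) = Neg (subst_fm \<sigma> \<phi>)"
| "subst_fm \<sigma> (Conj \<phi> \<psi>) = Conj (subst_fm \<sigma> \<phi>) (subst_fm \<sigma> \<psi>)"
| "subst_fm \<sigma> (Forall \<phi>) = Forall (subst_fm (lift_subst \<sigma>) \<phi>)"

text \<open>
  \<open>\<phi>(0) \<and> \<forall>x (\<phi>(x) \<rightarrow> \<phi>(x + 1)) \<rightarrow> \<forall>x \<phi>(x)\<close>, where \<open>x\<close> is index 0 of \<open>\<phi>\<close>; the other free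
  variables of \<open>\<phi>\<close> stay free in the axiom. The second substitution happens below a
  quantifier, so it keeps every index in place.
\<close>

definition induction_axiom :: "'a fm \<Rightarrow> 'a fm" where
  "induction_axiom \<phi> =
     Imp (Conj (subst_fm (case_nat Zero Var) \<phi>)
               (Forall (Imp \<phi> (subst_fm (case_nat (Add (Var 0) One) (\<lambda>i. Var (Suc i))) \<phi>))))
         (Forall \<phi>)"

text \<open>Free variables in the axioms are read as universally quantified.\<close>

definition PA :: "'a fm set" where
  "PA =
     { Neg (Eq (Add (Var 0) One) Zero),
       Imp (Eq (Add (Var 0) One) (Add (Var 1) One)) (Eq (Var 0) (Var 1)),
       Eq (Add Zero One) One,
       Eq (Add (Var 0) Zero) (Var 0),
       Eq (Add (Var 0) (Add (Var 1) One)) (Add (Add (Var 0) (Var 1)) One),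
       Eq (Mul (Var 0) Zero) Zero,
       Eq (Mul (Var 0) (Add (Var 1) One)) (Add (Mul (Var 0) (Var 1)) (Var 0)),
       Iff (Less (Var 0) (Var 1)) (Exists (Eq (Add (Var 1) (Add (Var 0) One)) (Var 2))) }
     \<union> {induction_axiom \<phi> | \<phi>. L_formula \<phi>}"

record 'a arith_struct =
  carrier :: "'a set"
  zero :: 'a
  one :: 'a
  add :: "'a \<Rightarrow> 'a \<Rightarrow> 'a"
  mul :: "'a \<Rightarrow> 'a \<Rightarrow> 'a"
  less :: "'a \<Rightarrow> 'a \<Rightarrow> bool"

definition is_structure :: "'a arith_struct \<Rightarrow> bool" where
  "is_structure M \<longleftrightarrow>
     zero M \<in> carrier M \<and> one M \<in> carrier M \<and>
     (\<forall>x\<in>carrier M. \<forall>y\<in>carrier M. add M x y \<in> carrier M \<and> mul M x y \<in> carrier M)"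

primrec eval :: "'a arith_struct \<Rightarrow> (nat \<Rightarrow> 'a) \<Rightarrow> 'a trm \<Rightarrow> 'a" where
  "eval M e (Var i) = e i"
| "eval M e (Par a) = a"
| "eval M e Zero = zero M"
| "eval M e One = one M"
| "eval M e (Add s t) = add M (eval M e s) (eval M e t)"
| "eval M e (Mul s t) = mul M (eval M e s) (eval M e t)"

text \<open>\<open>sat M B e \<phi>\<close>: satisfaction in the expansion \<open>(M, B)\<close>, where \<open>B\<close> interprets \<open>P\<close>.\<close>

primrec sat :: "'a arith_struct \<Rightarrow> 'a set \<Rightarrow> (nat \<Rightarrow> 'a) \<Rightarrow> 'a fm \<Rightarrow> bool" where
  "sat M B e (Eq s t) \<longleftrightarrow> eval M e s = eval M e t"
| "sat M B e (Less s t) \<longleftrightarrow> less M (eval M e s) (eval M e t)"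
| "sat M B e (InP t) \<longleftrightarrow> eval M e t \<in> B"
| "sat M B e (Neg \<phi>) \<longleftrightarrow> \<not> sat M B e \<phi>"
| "sat M B e (Conj \<phi> \<psi>) \<longleftrightarrow> sat M B e \<phi> \<and> sat M B e \<psi>"
| "sat M B e (Forall \<phi>) \<longleftrightarrow> (\<forall>a\<in>carrier M. sat M B (case_nat a e) \<phi>)"

definition holds :: "'a arith_struct \<Rightarrow> 'a set \<Rightarrow> 'a fm \<Rightarrow> bool" where
  "holds M B \<phi> \<longleftrightarrow> (\<forall>e. (\<forall>i. e i \<in> carrier M) \<longrightarrow> sat M B e \<phi>)"

text \<open>The axioms of \<open>PA\<close> do not contain \<open>P\<close>, so its interpretation \<open>{}\<close> here is immaterial.\<close>

definition PA_model :: "'a arith_struct \<Rightarrow> bool" where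
  "PA_model M \<longleftrightarrow> is_structure M \<and> (\<forall>\<phi>\<in>PA. holds M {} \<phi>)"

definition standard_part :: "'a arith_struct \<Rightarrow> 'a set" where
  "standard_part M = range (\<lambda>n::nat. ((\<lambda>x. add M x (one M)) ^^ n) (zero M))"

text \<open>
  If \<open>M\<close> is the standard model, the sentence \<open>\<forall>x P(x)\<close> trivially defines the standard part
  implicitly; the notion is of interest for nonstandard \<open>M\<close> only.
\<close>

definition implicitly_definable :: "'a arith_struct \<Rightarrow> 'a set \<Rightarrow> bool" where
  "implicitly_definable M S \<longleftrightarrow>
     (\<exists>\<phi>. sentence \<phi> \<and> set_fm \<phi> \<subseteq> carrier M \<and>
          {B. B \<subseteq> carrier M \<and> holds M B \<phi>} = {S})"

text \<open>
  ``There is a model'' ranges over sets of any size, but a HOL formula cannot quantify over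
  types. Models are taken on arbitrary subsets of one fixed large type, which has a
  copy of every model of cardinality at most \<open>\<beth>\<^sub>3\<close>.
\<close>

type_synonym universe = "nat set set set"

end

theory Submission
  imports Defs Complex_Main "HOL-Library.Countable_Set"
begin

text \<open>
  The model is \<open>\<nat>\<close> extended by a nonstandard code \<open>c\<close> of a slalom \<open>W(k, s)\<close> of residues modulo \<open>k\<close>
  and by continuum many mutually random numbers \<open>g\<^sub>x\<close>, where each element is a Skolem term in \<open>c\<close>
  and finitely many \<open>g\<^sub>x\<close>. A fusion argument arranges that

    \<^item> for each element \<open>z\<close> and all large standard \<open>k\<close>, the residue \<open>z mod k\<close> is in \<open>W(k, s)\<close> for all large
      standard \<open>s\<close>;
    \<^item> \<open>g\<^sub>x mod k\<close> is never in \<open>W(k, s)\<close> if \<open>k\<close> is nonstandard and \<open>k\<close>, \<open>s\<close> are terms without \<open>g\<^sub>x\<close>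
      and below a fixed nonstandard bound.

  The sentence says of \<open>P\<close> that it is a cut below this bound for which the first item holds with ``in \<open>P\<close>'' instead of
  ``standard''. If a nonstandard cut \<open>B\<close> satisfied it, there would be an \<open>x\<close> such that the elements of \<open>B\<close>
  that do not depend on \<open>g\<^sub>x\<close> are cofinal in \<open>B\<close> (this needs uncountably many \<open>x\<close>), and taking \<open>k\<close> and \<open>s\<close>
  from these contradicts the second item for \<open>z = g\<^sub>x\<close>. Such limits in \<open>s\<close> are needed because a slalom
  cannot catch all sets coded in a model that contains the slalom itself.
\<close>

text \<open>The tension is that each \<open>g\<close> must be caught at all large standard moduli
  and yet escape at the nonstandard ones. The bound \<open>sqrt k\<close> on the number of caught
  residues serves both: it grows without limit, so the residues of any given term find room from
  some standard \<open>k\<close> on, while the caught fraction \<open>1 / sqrt k\<close> tends to 0,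
  so a random number escapes at nonstandard moduli. Accordingly the two demands are treated by
  different means. A residue at a standard modulus is decided by extending the code and is then
  promised to all later blocks; escape only removes a set of points of small measure and needs no
  extension of the code.

  Countably many tasks suffice for continuum many generators. A Skolem term mentions finitely many
  branches of the binary tree, these are separated at some finite level, and what is arranged for
  tuples of nodes of that level is inherited by all tuples of branches through them. Inheritance
  holds because a point of level \<open>t + 1\<close>, whichever successor is chosen for each node,
  restricts to a point that meets the conditions of level \<open>t\<close>.\<close>

section \<open>Codes for slaloms\<close>

text \<open>Iterates the pairing \<open>(x + y) * (x + y) + x\<close>. Without division or
  subtraction, the triple code is literally a term of the language.\<close>

definition tri :: "nat \<Rightarrow> nat \<Rightarrow> nat \<Rightarrow> nat" where
  "tri k s r = ((k + s) * (k + s) + k + r) * ((k + s) * (k + s) + k + r) + r"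

text \<open>The value lies between the squares of \<open>x + y\<close> (inclusive) and of
  \<open>x + y + 1\<close> (exclusive), so it determines \<open>x + y\<close> and then
  \<open>x\<close>.\<close>

lemma sq_pair_inj:
  fixes x y x' y' :: nat
  assumes "(x + y) * (x + y) + x = (x' + y') * (x' + y') + x'"
  shows "x = x' \<and> y = y'"
proof -
  have aux: False if "(x + y) * (x + y) + x = (x' + y') * (x' + y') + x'" "x + y < x' + y'" for x y x' y' :: nat
  proof -
    have "Suc (x + y) * Suc (x + y) \<le> (x' + y') * (x' + y')"
      using that(2) by (intro mult_le_mono) auto
    then show False using that(1) by simp
  qed
  have "x + y = x' + y'"
    using aux[of x y x' y'] aux[of x' y' x y] assms by (metis linorder_neqE_nat)
  then show ?thesis using assms by auto
qed

lemma tri_inj: "tri k s r = tri k' s' r' \<longleftrightarrow> k = k' \<and> s = s' \<and> r = r'"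
proof
  assume eq: "tri k s r = tri k' s' r'"
  define u u' where "u = (k + s) * (k + s) + k" and "u' = (k' + s') * (k' + s') + k'"
  have "(r + u) * (r + u) + r = (r' + u') * (r' + u') + r'"
    using eq unfolding tri_def u_def u'_def by (simp add: algebra_simps)
  then have "r = r' \<and> u = u'" by (rule sq_pair_inj)
  then show "k = k' \<and> s = s' \<and> r = r'"
    using sq_pair_inj[of k s k' s'] unfolding u_def u'_def by auto
qed auto

text \<open>
  A code \<open>(a, m, b)\<close> describes a finite relation on triples below \<open>b\<close> as in Goedel's \<open>\<beta>\<close>-function:
  if \<open>m\<close> is a suitable factorial, the numbers \<open>1 + m (i + 1)\<close> are pairwise coprime, and \<open>a\<close> is the
  product of those whose index is in the relation. Above \<open>b\<close> divisibility may hold by accident.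
\<close>

type_synonym code = "nat \<times> nat \<times> nat"

definition bnd :: "code \<Rightarrow> nat" where "bnd c = snd (snd c)"

definition slalom :: "code \<Rightarrow> nat \<Rightarrow> nat \<Rightarrow> nat set" where
  "slalom c k s = {r. r < k \<and> (1 + fst (snd c) * (tri k s r + 1)) dvd fst c}"

definition good :: "code \<Rightarrow> bool" where
  "good c \<longleftrightarrow> (\<forall>k<bnd c. \<forall>s<bnd c. (card (slalom c k s))\<^sup>2 \<le> k)"

text \<open>
  A block is the part of a slalom that belongs to one value of \<open>s\<close>. The cardinality bound says that
  at argument \<open>k\<close> only a fraction \<open>1 / sqrt k\<close> of all residues is caught.
\<close>

type_synonym block = "(nat \<times> nat) set"

definition adm :: "block \<Rightarrow> bool" where
  "adm B \<longleftrightarrow> finite B \<and> (\<forall>k r. (k, r) \<in> B \<longrightarrow> r < k) \<and> (\<forall>k. (card {r. (k, r) \<in> B})\<^sup>2 \<le> k)"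

definition codes :: "code \<Rightarrow> block list \<Rightarrow> bool" where
  "codes c p \<longleftrightarrow> (\<forall>s<length p. \<forall>(k, r) \<in> p ! s. r \<in> slalom c k s)"

text \<open>A common divisor divides the difference of suitable multiples of the two numbers, which
  is \<open>j - i\<close>. This divides \<open>fact N\<close>, so the divisor divides
  \<open>m\<close> and hence 1.\<close>

lemma coprime_arith:
  fixes m i j N :: nat
  assumes "i \<noteq> j" "i \<le> N" "j \<le> N" "m = fact N"
  shows "coprime (1 + m * (i + 1)) (1 + m * (j + 1))"
proof -
  have gen: "coprime (1 + m * (i + 1)) (1 + m * (j + 1))" if ij: "i < j" "j \<le> N" for i j
  proof (rule coprimeI)
    fix d assume d: "d dvd 1 + m * (i + 1)" "d dvd 1 + m * (j + 1)"
    have "(j + 1) * (1 + m * (i + 1)) = (i + 1) * (1 + m * (j + 1)) + (j - i)"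
    proof -
      obtain e where e: "j = i + e" using ij(1) less_imp_add_positive by blast
      show ?thesis unfolding e by (simp add: algebra_simps)
    qed
    moreover have "d dvd (j + 1) * (1 + m * (i + 1))" "d dvd (i + 1) * (1 + m * (j + 1))"
      using d by (simp_all only: dvd_mult)
    ultimately have "d dvd j - i" using dvd_add_right_iff by metis
    moreover have "j - i dvd m" unfolding assms(4) using ij by (intro dvd_fact) auto
    ultimately have "d dvd m * (i + 1)" by (meson dvd_mult2 dvd_trans)
    then show "is_unit d" using d(1) by (metis dvd_add_left_iff)
  qed
  show ?thesis
  proof (cases "i < j")
    case True then show ?thesis using gen assms by blast
  next
    case False
    then have "j < i" using assms(1) by simp
    then show ?thesis using gen[of j i] assms(2) by (simp add: coprime_commute)
  qed
qed

lemma dvd_prod_coprime_iff: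
  fixes T :: "nat set"
  assumes "finite T" "T \<subseteq> {..N}" "i \<le> N" "m = fact N"
  shows "(1 + m * (i + 1)) dvd (\<Prod>j\<in>T. 1 + m * (j + 1)) \<longleftrightarrow> i \<in> T"
proof
  assume dvd: "(1 + m * (i + 1)) dvd (\<Prod>j\<in>T. 1 + m * (j + 1))"
  show "i \<in> T"
  proof (rule ccontr)
    assume "i \<notin> T"
    then have "coprime (1 + m * (i + 1)) (\<Prod>j\<in>T. 1 + m * (j + 1))"
      using assms by (intro prod_coprime_right coprime_arith[of i _ N m]) auto
    then have "is_unit (1 + m * (i + 1))" using dvd by (meson coprime_common_divisor dvd_refl)
    then show False using assms(4) by simp
  qed
next
  assume "i \<in> T" then show "(1 + m * (i + 1)) dvd (\<Prod>j\<in>T. 1 + m * (j + 1))"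
    by (intro dvd_prodI[OF assms(1)])
qed

text \<open>The free choice of \<open>r\<close> makes the bound of the code as large as desired,
  whatever blocks are prescribed.\<close>

lemma code_exists:
  assumes "\<forall>B\<in>set p. adm B"
  shows "\<exists>c. good c \<and> codes c p \<and> r \<le> bnd c"
proof -
  define T where "T = (\<Union>s<length p. (\<lambda>(k, r). tri k s r) ` (p ! s))"
  have fin: "finite (p ! s)" if "s < length p" for s
    using assms that nth_mem unfolding adm_def by blast
  have finT: "finite T" unfolding T_def using fin by blast
  \<comment> \<open>\<open>good\<close> inspects all triples with \<open>k\<close> and
    \<open>s\<close> below the bound \<open>r\<close> and residue below \<open>k\<close>. Keeping
    their codes below \<open>N\<close> excludes accidental divisibility there.\<close>
  define T' where "T' = T \<union> (\<lambda>(k, s, r). tri k s r) ` ({..r} \<times> {..r} \<times> {..r})"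
  have finT': "finite T'" unfolding T'_def using finT by auto
  define N where "N = Max (insert 0 T')"
  have N: "x \<le> N" if "x \<in> T'" for x using that finT' unfolding N_def by auto
  define m :: nat where "m = fact N"
  define a where "a = (\<Prod>j\<in>T. 1 + m * (j + 1))"
  define c :: code where "c = (a, m, r)"
  have TN: "T \<subseteq> {..N}" using N unfolding T'_def by auto
  have memT: "tri k s q \<in> T \<longleftrightarrow> s < length p \<and> (k, q) \<in> p ! s" for k s q
  proof
    assume "tri k s q \<in> T"
    then obtain s' k' q' where h: "s' < length p" "(k', q') \<in> p ! s'" "tri k s q = tri k' s' q'"
      unfolding T_def by fastforce
    then show "s < length p \<and> (k, q) \<in> p ! s" unfolding tri_inj by blast
  next
    assume "s < length p \<and> (k, q) \<in> p ! s"
    then show "tri k s q \<in> T" unfolding T_def by force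
  qed
  have sl: "q \<in> slalom c k s \<longleftrightarrow> q < k \<and> s < length p \<and> (k, q) \<in> p ! s" if "tri k s q \<le> N" for k s q
  proof -
    have "(1 + m * (tri k s q + 1)) dvd a \<longleftrightarrow> tri k s q \<in> T"
      unfolding a_def by (rule dvd_prod_coprime_iff[OF finT TN that m_def])
    then show ?thesis unfolding slalom_def c_def memT fst_conv snd_conv mem_Collect_eq by blast
  qed
  have "codes c p"
    unfolding codes_def
  proof (intro allI impI ballI, clarify)
    fix s k q assume s: "s < length p" and kq: "(k, q) \<in> p ! s"
    have "q < k" using assms s kq nth_mem unfolding adm_def by blast
    moreover have "tri k s q \<le> N" using s kq memT TN by auto
    ultimately show "q \<in> slalom c k s" using sl s kq by blast
  qed
  moreover have "good c"
    unfolding good_def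
  proof (intro allI impI)
    fix k s assume k: "k < bnd c" and s: "s < bnd c"
    have N': "tri k s q \<le> N" if "q < k" for q
      using k s that by (intro N) (auto simp: T'_def bnd_def c_def intro!: image_eqI[where x="(k, s, q)"])
    show "(card (slalom c k s))\<^sup>2 \<le> k"
    proof (cases "s < length p")
      case True
      have "adm (p ! s)" using assms True nth_mem by blast
      then have f: "finite {q. (k, q) \<in> p ! s}" and cd: "(card {q. (k, q) \<in> p ! s})\<^sup>2 \<le> k"
        unfolding adm_def using finite_subset[of "{q. (k, q) \<in> p ! s}" "snd ` (p ! s)"]
        by (force, blast)
      have "slalom c k s \<subseteq> {q. (k, q) \<in> p ! s}"
        using sl N' by (auto simp: slalom_def)
      then have "card (slalom c k s) \<le> card {q. (k, q) \<in> p ! s}"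
        using f card_mono by blast
      then show ?thesis using cd by (meson le_trans power_mono zero_le)
    next
      case False
      then have "slalom c k s = {}" using sl N' by (auto simp: slalom_def)
      then show ?thesis by simp
    qed
  qed
  ultimately show ?thesis by (intro exI[of _ c]) (auto simp: c_def bnd_def)
qed

section \<open>Fusion\<close>

definition pts :: "nat \<Rightarrow> nat \<Rightarrow> nat list set" where
  "pts b n = {ys. set ys \<subseteq> {..<b} \<and> length ys = n}"

lemma finite_pts [simp]: "finite (pts b n)"
  unfolding pts_def by (rule finite_lists_length_eq) simp

lemma card_pts: "card (pts b n) = b ^ n"
  unfolding pts_def by (subst card_lists_length_eq) auto

lemma finite_pts_Collect [simp]: "finite {ys \<in> pts b n. P ys}"
  by (rule finite_subset[OF _ finite_pts[of b n]]) auto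

lemma length_pts: "ys \<in> pts b n \<Longrightarrow> length ys = n"
  by (simp add: pts_def)

lemma pts_snoc: "ys \<in> pts b n \<Longrightarrow> a < b \<Longrightarrow> ys @ [a] \<in> pts b (Suc n)"
  by (auto simp: pts_def)

definition above :: "block \<Rightarrow> block list \<Rightarrow> bool" where
  "above Pr q \<longleftrightarrow> (\<forall>B\<in>set q. adm B \<and> Pr \<subseteq> B)"

text \<open>
  The conditions of the fusion. The blocks \<open>p\<close> are already in the slalom, all later blocks will contain
  \<open>Pr\<close>, and \<open>Q\<close> is the set of pairs that are still allowed. Every continuation of \<open>p\<close> that keeps the
  promise has a code for which a fraction \<open>\<delta>\<close> of all points is allowed: the code is treated as in
  Cohen forcing, the points as in random forcing.
\<close>

definition large :: "nat \<Rightarrow> block list \<Rightarrow> block \<Rightarrow> (code \<Rightarrow> nat list \<Rightarrow> bool) \<Rightarrow> bool" where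
  "large n p Pr Q \<longleftrightarrow> (\<exists>\<delta>>0. \<forall>q. above Pr q \<longrightarrow>
     (\<exists>c. good c \<and> codes c (p @ q) \<and> length (p @ q) < bnd c \<and>
          \<delta> * real (bnd c) ^ n \<le> real (card {ys \<in> pts (bnd c) n. Q c ys})))"

lemma above_append: "above Pr (q @ q') \<longleftrightarrow> above Pr q \<and> above Pr q'"
  by (auto simp: above_def)

lemma above_mono: "Pr \<subseteq> Pr' \<Longrightarrow> above Pr' q \<Longrightarrow> above Pr q"
  by (auto simp: above_def)

lemma large_mono:
  assumes "large n p Pr Q" "\<And>c ys. length ys = n \<Longrightarrow> Q c ys \<Longrightarrow> Q' c ys"
  shows "large n p Pr Q'"
proof -
  have "real (card {ys \<in> pts (bnd c) n. Q c ys}) \<le> real (card {ys \<in> pts (bnd c) n. Q' c ys})" for c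
    by (intro of_nat_mono card_mono) (simp, use assms(2) length_pts in blast)
  then show ?thesis using assms(1) unfolding large_def by (meson order_trans)
qed

text \<open>A stronger promise leaves fewer continuations for which a code has to be
  provided.\<close>

lemma large_promise:
  assumes "large n p Pr Q" "Pr \<subseteq> Pr'"
  shows "large n p Pr' Q"
  using assms(1) above_mono[OF assms(2)] unfolding large_def by fast

lemma large_append:
  assumes "large n p Pr Q" "above Pr q"
  shows "large n (p @ q) Pr Q"
proof -
  obtain \<delta> where \<delta>: "\<delta> > 0" and L: "\<And>q. above Pr q \<Longrightarrow>
     \<exists>c. good c \<and> codes c (p @ q) \<and> length (p @ q) < bnd c \<and>
          \<delta> * real (bnd c) ^ n \<le> real (card {ys \<in> pts (bnd c) n. Q c ys})"
    using assms(1) unfolding large_def by blast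
  show ?thesis unfolding large_def append_assoc
  proof (intro exI[of _ \<delta>] conjI \<delta> allI impI)
    fix q' assume "above Pr q'"
    then show "\<exists>c. good c \<and> codes c (p @ q @ q') \<and> length (p @ q @ q') < bnd c \<and>
        \<delta> * real (bnd c) ^ n \<le> real (card {ys \<in> pts (bnd c) n. Q c ys})"
      using assms(2) by (intro L) (simp add: above_append)
  qed
qed

text \<open>A forcing dichotomy. If \<open>Q1\<close> does not get half of \<open>\<delta>\<close>
  at every continuation, some \<open>q\<close> has no code that gives it that much. Codes of longer
  continuations also code \<open>p @ q\<close>, so from there on the other half falls to
  \<open>Q2\<close>.\<close>

lemma large_union:
  assumes "large n p Pr Q" "\<And>c ys. length ys = n \<Longrightarrow> Q c ys \<Longrightarrow> Q1 c ys \<or> Q2 c ys"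
  shows "large n p Pr Q1 \<or> (\<exists>q. above Pr q \<and> large n (p @ q) Pr Q2)"
proof -
  obtain \<delta> where \<delta>: "\<delta> > 0" and L: "\<And>q. above Pr q \<Longrightarrow>
     \<exists>c. good c \<and> codes c (p @ q) \<and> length (p @ q) < bnd c \<and>
          \<delta> * real (bnd c) ^ n \<le> real (card {ys \<in> pts (bnd c) n. Q c ys})"
    using assms(1) unfolding large_def by blast
  show ?thesis
  proof (cases "\<forall>q. above Pr q \<longrightarrow>
     (\<exists>c. good c \<and> codes c (p @ q) \<and> length (p @ q) < bnd c \<and>
          \<delta>/2 * real (bnd c) ^ n \<le> real (card {ys \<in> pts (bnd c) n. Q1 c ys}))")
    case True
    then have "large n p Pr Q1" unfolding large_def using \<delta> by (intro exI[of _ "\<delta>/2"]) auto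
    then show ?thesis ..
  next
    case False
    then obtain q where q: "above Pr q" and no: "\<And>c. good c \<Longrightarrow> codes c (p @ q) \<Longrightarrow> length (p @ q) < bnd c \<Longrightarrow>
          real (card {ys \<in> pts (bnd c) n. Q1 c ys}) < \<delta>/2 * real (bnd c) ^ n"
      by (meson not_le)
    have "large n (p @ q) Pr Q2"
      unfolding large_def
    proof (intro exI[of _ "\<delta>/2"] conjI allI impI)
      fix q' assume "above Pr q'"
      then have "above Pr (q @ q')" using q by (simp add: above_append)
      then obtain c where c: "good c" "codes c (p @ q @ q')" "length (p @ q @ q') < bnd c"
        "\<delta> * real (bnd c) ^ n \<le> real (card {ys \<in> pts (bnd c) n. Q c ys})"
        using L by blast
      have "codes c (p @ q)"
        using c(2) unfolding codes_def append_assoc[symmetric]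
        by (metis (no_types, lifting) length_append nth_append trans_less_add1)
      then have "real (card {ys \<in> pts (bnd c) n. Q1 c ys}) < \<delta>/2 * real (bnd c) ^ n"
        using no c by simp
      moreover have "card {ys \<in> pts (bnd c) n. Q c ys}
          \<le> card ({ys \<in> pts (bnd c) n. Q1 c ys} \<union> {ys \<in> pts (bnd c) n. Q2 c ys})"
        by (intro card_mono) (simp, use assms(2) length_pts in blast)
      then have "card {ys \<in> pts (bnd c) n. Q c ys}
          \<le> card {ys \<in> pts (bnd c) n. Q1 c ys} + card {ys \<in> pts (bnd c) n. Q2 c ys}"
        using card_Un_le order_trans by blast
      ultimately have "\<delta>/2 * real (bnd c) ^ n \<le> real (card {ys \<in> pts (bnd c) n. Q2 c ys})"
        using c(4) by (simp add: field_simps)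
      then show "\<exists>c. good c \<and> codes c ((p @ q) @ q') \<and> length ((p @ q) @ q') < bnd c \<and>
          \<delta>/2 * real (bnd c) ^ n \<le> real (card {ys \<in> pts (bnd c) n. Q2 c ys})"
        using c(1-3) unfolding append_assoc by blast
    qed (use \<delta> in auto)
    then show ?thesis using q by blast
  qed
qed

text \<open>Splits off the largest possible value by \<open>large_union\<close> until one value is
  large. With no values left, \<open>Q\<close> would be empty, against
  \<open>\<delta> > 0\<close>.\<close>

lemma large_decide:
  assumes "large n p Pr Q" "\<And>c ys. length ys = n \<Longrightarrow> Q c ys \<Longrightarrow> f c ys < (k::nat)"
  shows "\<exists>q v. above Pr q \<and> v < k \<and> large n (p @ q) Pr (\<lambda>c ys. Q c ys \<and> f c ys = v)"
  using assms
proof (induction k arbitrary: p Q)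
  case 0
  obtain \<delta> where \<delta>: "\<delta> > 0" and L: "\<And>q. above Pr q \<Longrightarrow>
     \<exists>c. good c \<and> codes c (p @ q) \<and> length (p @ q) < bnd c \<and>
          \<delta> * real (bnd c) ^ n \<le> real (card {ys \<in> pts (bnd c) n. Q c ys})"
    using 0(1) unfolding large_def by blast
  obtain c where c: "length p < bnd c" "\<delta> * real (bnd c) ^ n \<le> real (card {ys \<in> pts (bnd c) n. Q c ys})"
    using L[of "[]"] by (auto simp: above_def)
  have E: "{ys \<in> pts (bnd c) n. Q c ys} = {}" using 0(2) length_pts by blast
  have "\<delta> * real (bnd c) ^ n \<le> 0" using c(2) unfolding E by simp
  moreover have "0 < \<delta> * real (bnd c) ^ n" using \<delta> c(1) by simp
  ultimately show ?case by simp
next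
  case (Suc k)
  from large_union[OF Suc.prems(1), of "\<lambda>c ys. Q c ys \<and> f c ys = k" "\<lambda>c ys. Q c ys \<and> f c ys < k"]
  consider "large n p Pr (\<lambda>c ys. Q c ys \<and> f c ys = k)"
    | q where "above Pr q" "large n (p @ q) Pr (\<lambda>c ys. Q c ys \<and> f c ys < k)"
    using Suc.prems(2) less_Suc_eq by blast
  then show ?case
  proof cases
    case 1
    then show ?thesis by (intro exI[of _ "[]"] exI[of _ k]) (auto simp: above_def)
  next
    case (2 q)
    obtain q' v where "above Pr q'" "v < k" "large n ((p @ q) @ q') Pr (\<lambda>c ys. (Q c ys \<and> f c ys < k) \<and> f c ys = v)"
      using Suc.IH[OF 2(2)] by auto
    then show ?thesis using 2(1)
      by (intro exI[of _ "q @ q'"] exI[of _ v]) (auto simp: above_append elim: large_mono)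
  qed
qed

text \<open>The threshold \<open>m\<close> depends on \<open>\<delta>\<close> but works for all good
  codes at once. Therefore \<open>p\<close> need not be extended, unlike in
  \<open>large_decide\<close>.\<close>

lemma large_remove:
  assumes L: "large n p Pr Q"
    and small: "\<And>\<epsilon>. \<epsilon> > 0 \<Longrightarrow> \<exists>m::nat. \<forall>c. good c \<longrightarrow> 0 < bnd c \<longrightarrow>
        real (card {ys \<in> pts (bnd c) n. E m c ys}) \<le> \<epsilon> * real (bnd c) ^ n"
  shows "\<exists>m. large n p Pr (\<lambda>c ys. Q c ys \<and> \<not> E m c ys)"
proof -
  obtain \<delta> where \<delta>: "\<delta> > 0" and L: "\<And>q. above Pr q \<Longrightarrow>
     \<exists>c. good c \<and> codes c (p @ q) \<and> length (p @ q) < bnd c \<and>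
          \<delta> * real (bnd c) ^ n \<le> real (card {ys \<in> pts (bnd c) n. Q c ys})"
    using L unfolding large_def by blast
  obtain m where m: "\<And>c. good c \<Longrightarrow> 0 < bnd c \<Longrightarrow>
        real (card {ys \<in> pts (bnd c) n. E m c ys}) \<le> \<delta>/2 * real (bnd c) ^ n"
    using small[of "\<delta>/2"] \<delta> by auto
  have "large n p Pr (\<lambda>c ys. Q c ys \<and> \<not> E m c ys)"
    unfolding large_def
  proof (intro exI[of _ "\<delta>/2"] conjI allI impI)
    fix q assume "above Pr q"
    then obtain c where c: "good c" "codes c (p @ q)" "length (p @ q) < bnd c"
        "\<delta> * real (bnd c) ^ n \<le> real (card {ys \<in> pts (bnd c) n. Q c ys})"
      using L by blast
    have "card {ys \<in> pts (bnd c) n. Q c ys}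
        \<le> card ({ys \<in> pts (bnd c) n. E m c ys} \<union> {ys \<in> pts (bnd c) n. Q c ys \<and> \<not> E m c ys})"
      by (intro card_mono) auto
    then have "card {ys \<in> pts (bnd c) n. Q c ys}
        \<le> card {ys \<in> pts (bnd c) n. E m c ys} + card {ys \<in> pts (bnd c) n. Q c ys \<and> \<not> E m c ys}"
      using card_Un_le order_trans by blast
    then have "\<delta>/2 * real (bnd c) ^ n \<le> real (card {ys \<in> pts (bnd c) n. Q c ys \<and> \<not> E m c ys})"
      using c(3,4) m[OF c(1)] by (simp add: field_simps)
    then show "\<exists>c. good c \<and> codes c (p @ q) \<and> length (p @ q) < bnd c \<and>
          \<delta>/2 * real (bnd c) ^ n \<le> real (card {ys \<in> pts (bnd c) n. Q c ys \<and> \<not> E m c ys})"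
      using c by blast
  qed (use \<delta> in auto)
  then show ?thesis by blast
qed

lemma large_init: "large n [] {} (\<lambda>_ _. True)"
  unfolding large_def
proof (intro exI[of _ 1] conjI allI impI)
  fix q assume q: "above {} q"
  obtain c where "good c" "codes c q" "Suc (length q) \<le> bnd c"
    using code_exists[of q "Suc (length q)"] q by (auto simp: above_def)
  then show "\<exists>c. good c \<and> codes c ([] @ q) \<and> length ([] @ q) < bnd c \<and>
          1 * real (bnd c) ^ n \<le> real (card {ys \<in> pts (bnd c) n. True})"
    by (intro exI[of _ c]) (auto simp: card_pts)
qed simp

lemma large_nonempty:
  assumes "large n p Pr Q"
  shows "\<exists>c ys. good c \<and> codes c p \<and> length p < bnd c \<and> ys \<in> pts (bnd c) n \<and> Q c ys"
proof -
  obtain \<delta> where \<delta>: "\<delta> > 0" and L: "\<And>q. above Pr q \<Longrightarrow>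
     \<exists>c. good c \<and> codes c (p @ q) \<and> length (p @ q) < bnd c \<and>
          \<delta> * real (bnd c) ^ n \<le> real (card {ys \<in> pts (bnd c) n. Q c ys})"
    using assms(1) unfolding large_def by blast
  obtain c where c: "good c" "codes c p" "length p < bnd c" "\<delta> * real (bnd c) ^ n \<le> real (card {ys \<in> pts (bnd c) n. Q c ys})"
    using L[of "[]"] by (auto simp: above_def)
  have "0 < \<delta> * real (bnd c) ^ n" using \<delta> c(3) by simp
  then have "{ys \<in> pts (bnd c) n. Q c ys} \<noteq> {}" using c(4) by (metis card.empty not_le of_nat_0)
  then show ?thesis using c by blast
qed

section \<open>Counting along one coordinate\<close>

lemma card_erased:
  assumes "u < n" "D \<subseteq> pts b n" "0 < b"
  shows "card ((\<lambda>ys. ys[u := 0]) ` D) * b \<le> b ^ n"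
proof -
  let ?C = "(\<lambda>ys. ys[u := 0]) ` D"
  have finC: "finite ?C" using assms(2) finite_subset[OF _ finite_pts] by blast
  have "inj_on (\<lambda>(ys, a). ys[u := a]) (?C \<times> {..<b})"
  proof (rule inj_onI, clarify)
    fix ys a ys' a'
    assume h: "ys \<in> D" "ys' \<in> D" "(ys[u := 0])[u := a] = (ys'[u := 0])[u := a']"
    have l: "length ys = n" "length ys' = n" using h assms(2) by (auto simp: pts_def)
    have "((ys[u := 0])[u := a]) ! u = ((ys'[u := 0])[u := a']) ! u" using h(3) by simp
    then have "a = a'" using l assms(1) by simp
    moreover have "((ys[u := 0])[u := a])[u := 0] = ((ys'[u := 0])[u := a'])[u := 0]" using h(3) by simp
    then have "ys[u := 0] = ys'[u := 0]" by simp
    ultimately show "ys[u := 0] = ys'[u := 0] \<and> a = a'" by blast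
  qed
  moreover have "(\<lambda>(ys, a). ys[u := a]) ` (?C \<times> {..<b}) \<subseteq> pts b n"
    using assms by (auto simp: pts_def dest!: set_update_subset_insert[THEN subsetD])
  ultimately have "card (?C \<times> {..<b}) \<le> card (pts b n)"
    using card_inj_on_le finite_pts by blast
  then show ?thesis by (simp add: card_pts card_cartesian_product)
qed

lemma card_sum_fibres:
  assumes "finite D"
  shows "card D = (\<Sum>r\<in>\<rho> ` D. card {y \<in> D. \<rho> y = r})"
proof -
  have "card (\<Union>r\<in>\<rho> ` D. {y \<in> D. \<rho> y = r}) = (\<Sum>r\<in>\<rho> ` D. card {y \<in> D. \<rho> y = r})"
    using assms by (intro card_UN_disjoint) auto
  moreover have "(\<Union>r\<in>\<rho> ` D. {y \<in> D. \<rho> y = r}) = D" by auto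
  ultimately show ?thesis by simp
qed

text \<open>Fubini for counting measure: the fibres over the other coordinates have at most
  \<open>B\<close> elements, and by \<open>card_erased\<close> there are at most
  \<open>b ^ n / b\<close> of them.\<close>

lemma card_small_fibres:
  assumes "u < n" "D \<subseteq> pts b n" "0 < b"
    and fib: "\<And>ys. ys \<in> D \<Longrightarrow> card {a. a < b \<and> ys[u := a] \<in> D} \<le> B"
  shows "card D * b \<le> B * b ^ n"
proof -
  let ?\<rho> = "\<lambda>ys::nat list. ys[u := 0]"
  have fin: "finite D" using assms(2) finite_subset finite_pts by blast
  have le: "card {y \<in> D. ?\<rho> y = r} \<le> B" if r: "r \<in> ?\<rho> ` D" for r
  proof -
    obtain ys where ys: "ys \<in> D" "r = ?\<rho> ys" using r by blast
    have "inj_on (\<lambda>y. y ! u) {y \<in> D. ?\<rho> y = r}"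
    proof (rule inj_onI)
      fix y y' assume y: "y \<in> {y \<in> D. ?\<rho> y = r}" "y' \<in> {y \<in> D. ?\<rho> y = r}" "y ! u = y' ! u"
      have "y = (?\<rho> y)[u := y ! u]" by simp
      also have "\<dots> = (?\<rho> y')[u := y' ! u]" using y by auto
      finally show "y = y'" by simp
    qed
    moreover have "(\<lambda>y. y ! u) ` {y \<in> D. ?\<rho> y = r} \<subseteq> {a. a < b \<and> ys[u := a] \<in> D}"
    proof (rule image_subsetI)
      fix y assume "y \<in> {y \<in> D. ?\<rho> y = r}"
      then have y: "y \<in> D" "?\<rho> y = r" by auto
      have "ys[u := y ! u] = (?\<rho> ys)[u := y ! u]" by simp
      also have "\<dots> = y" using y(2) ys(2) by (metis list_update_id list_update_overwrite)
      finally have "ys[u := y ! u] \<in> D" using y by simp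
      moreover have "y ! u < b" using y(1) assms(1,2) nth_mem unfolding pts_def by blast
      ultimately show "y ! u \<in> {a. a < b \<and> ys[u := a] \<in> D}" by blast
    qed
    ultimately have "card {y \<in> D. ?\<rho> y = r} \<le> card {a. a < b \<and> ys[u := a] \<in> D}"
      by (intro card_inj_on_le) auto
    then show ?thesis using fib[OF ys(1)] by simp
  qed
  have "card D \<le> (\<Sum>r\<in>?\<rho> ` D. B)"
    unfolding card_sum_fibres[OF fin, of ?\<rho>] by (intro sum_mono le)
  then have "card D \<le> card (?\<rho> ` D) * B" by simp
  then have "card D * b \<le> (card (?\<rho> ` D) * b) * B" using mult_le_mono1 by (simp add: mult.commute mult.left_commute)
  also have "\<dots> \<le> b ^ n * B" using card_erased[OF assms(1-3)] by (rule mult_le_mono1)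
  finally show ?thesis by (simp add: mult.commute)
qed

text \<open>Cauchy-Schwarz against the constant 1.\<close>

lemma sum_power2_le:
  fixes x :: "'a \<Rightarrow> real"
  assumes "finite A"
  shows "(\<Sum>i\<in>A. x i)\<^sup>2 \<le> (\<Sum>i\<in>A. (x i)\<^sup>2) * real (card A)"
  using assms
proof (induction A)
  case (insert a A)
  have "2 * (\<Sum>i\<in>A. x i) * x a = (\<Sum>i\<in>A. 2 * x i * x a)"
    by (simp add: sum_distrib_left sum_distrib_right mult.assoc)
  also have "\<dots> \<le> (\<Sum>i\<in>A. (x i)\<^sup>2 + (x a)\<^sup>2)" by (intro sum_mono sum_squares_bound)
  finally have "2 * (\<Sum>i\<in>A. x i) * x a \<le> (\<Sum>i\<in>A. (x i)\<^sup>2) + real (card A) * (x a)\<^sup>2"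
    by (simp add: sum.distrib)
  then show ?case using insert by (simp add: power2_sum algebra_simps)
qed simp

text \<open>
  Giving coordinate \<open>u\<close> an independent copy that satisfies the same condition squares the measure
  at worst, by Cauchy-Schwarz on the fibres over the other coordinates.
\<close>

lemma card_copy:
  assumes "u < n" "D \<subseteq> pts b n" "0 < b"
    and D': "\<And>ys a. ys \<in> D \<Longrightarrow> a < b \<Longrightarrow> ys[u := a] \<in> D \<Longrightarrow> ys @ [a] \<in> D'"
    and "finite D'"
  shows "(card D)\<^sup>2 * b \<le> card D' * b ^ n"
proof -
  let ?\<rho> = "\<lambda>ys::nat list. ys[u := 0]"
  let ?n = "\<lambda>r. card {y \<in> D. ?\<rho> y = r}"
  have fin: "finite D" using assms(2) finite_subset finite_pts by blast
  let ?P = "SIGMA y:D. {y' \<in> D. ?\<rho> y' = ?\<rho> y}"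
  have "inj_on (\<lambda>(y, y'). y @ [y' ! u]) ?P"
  proof (rule inj_onI)
    fix w w' assume w: "w \<in> ?P" "w' \<in> ?P" "(case w of (y, y') \<Rightarrow> y @ [y' ! u]) = (case w' of (y, y') \<Rightarrow> y @ [y' ! u])"
    obtain x x' y y' where e: "w = (x, x')" "w' = (y, y')" by fastforce
    have h: "?\<rho> x' = ?\<rho> x" "?\<rho> y' = ?\<rho> y" "x = y" "x' ! u = y' ! u"
      using w unfolding e by auto
    have "x' = (?\<rho> x')[u := x' ! u]" by simp
    also have "\<dots> = (?\<rho> y')[u := y' ! u]" unfolding h by simp
    also have "\<dots> = y'" by simp
    finally show "w = w'" using h e by simp
  qed
  moreover have "(\<lambda>(y, y'). y @ [y' ! u]) ` ?P \<subseteq> D'"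
  proof clarify
    fix y y' assume y: "y \<in> D" "y' \<in> D" "?\<rho> y' = ?\<rho> y"
    have "y[u := y' ! u] = (?\<rho> y)[u := y' ! u]" by simp
    also have "\<dots> = y'" using y(3) by (metis list_update_id list_update_overwrite)
    finally have "y[u := y' ! u] \<in> D" using y by simp
    moreover have "y' ! u < b" using y(2) assms(1,2) nth_mem unfolding pts_def by blast
    ultimately show "y @ [y' ! u] \<in> D'" using D' y by blast
  qed
  ultimately have P: "card ?P \<le> card D'" using card_inj_on_le assms(5) by blast
  have "card ?P = (\<Sum>y\<in>D. ?n (?\<rho> y))" using fin by (subst card_SigmaI) auto
  also have "\<dots> = (\<Sum>r\<in>?\<rho> ` D. \<Sum>y\<in>{y \<in> D. ?\<rho> y = r}. ?n (?\<rho> y))"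
    using sum.image_gen[OF fin, of "\<lambda>y. ?n (?\<rho> y)" ?\<rho>] .
  also have "\<dots> = (\<Sum>r\<in>?\<rho> ` D. ?n r * ?n r)" by (intro sum.cong) auto
  finally have P2: "card ?P = (\<Sum>r\<in>?\<rho> ` D. (?n r)\<^sup>2)" by (simp add: power2_eq_square)
  have "(\<Sum>r\<in>?\<rho> ` D. real (?n r))\<^sup>2 \<le> (\<Sum>r\<in>?\<rho> ` D. (real (?n r))\<^sup>2) * real (card (?\<rho> ` D))"
    using fin by (intro sum_power2_le) simp
  then have "(real (card D))\<^sup>2 \<le> real (card ?P) * real (card (?\<rho> ` D))"
    unfolding card_sum_fibres[OF fin, of ?\<rho>] P2 by simp
  then have "(card D)\<^sup>2 \<le> card ?P * card (?\<rho> ` D)"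
    unfolding of_nat_power[symmetric] of_nat_mult[symmetric] of_nat_le_iff .
  then have "(card D)\<^sup>2 * b \<le> (card ?P * card (?\<rho> ` D)) * b" by (rule mult_le_mono1)
  also have "\<dots> = card ?P * (card (?\<rho> ` D) * b)" by (rule mult.assoc)
  also have "\<dots> \<le> card D' * b ^ n"
    using card_erased[OF assms(1-3)] P by (intro mult_le_mono)
  finally show ?thesis .
qed

text \<open>\<open>card_copy\<close> turns the density \<open>\<delta>\<close> into
  \<open>\<delta>\<^sup>2\<close>, which is still positive and independent of the code.\<close>

lemma large_copy:
  assumes L: "large n p Pr Q" and u: "u < n"
  shows "large (Suc n) p Pr (\<lambda>c zs. Q c (take n zs) \<and> Q c ((take n zs)[u := zs ! n]))"
proof -
  obtain \<delta> where \<delta>: "\<delta> > 0" and L: "\<And>q. above Pr q \<Longrightarrow>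
     \<exists>c. good c \<and> codes c (p @ q) \<and> length (p @ q) < bnd c \<and>
          \<delta> * real (bnd c) ^ n \<le> real (card {ys \<in> pts (bnd c) n. Q c ys})"
    using L unfolding large_def by blast
  let ?Q = "\<lambda>c zs. Q c (take n zs) \<and> Q c ((take n zs)[u := zs ! n])"
  show ?thesis
    unfolding large_def
  proof (intro exI[of _ "\<delta>\<^sup>2"] conjI allI impI)
    fix q assume "above Pr q"
    then obtain c where c: "good c" "codes c (p @ q)" "length (p @ q) < bnd c"
        "\<delta> * real (bnd c) ^ n \<le> real (card {ys \<in> pts (bnd c) n. Q c ys})"
      using L by blast
    let ?b = "real (bnd c)" and ?D = "{ys \<in> pts (bnd c) n. Q c ys}" and ?D' = "{ys \<in> pts (bnd c) (Suc n). ?Q c ys}"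
    have b: "0 < bnd c" using c(3) by simp
    have "(card ?D)\<^sup>2 * bnd c \<le> card ?D' * bnd c ^ n"
      using u b
      by (intro card_copy[of u n]) (auto simp: length_pts nth_append intro: pts_snoc)
    then have "real ((card ?D)\<^sup>2 * bnd c) \<le> real (card ?D' * bnd c ^ n)" by (rule of_nat_mono)
    then have 1: "(real (card ?D))\<^sup>2 * ?b \<le> real (card ?D') * ?b ^ n" by simp
    have "(\<delta> * ?b ^ n)\<^sup>2 \<le> (real (card ?D))\<^sup>2" using c(4) \<delta> by (intro power_mono) auto
    then have "(\<delta> * ?b ^ n)\<^sup>2 * ?b \<le> real (card ?D') * ?b ^ n"
      using 1 b by (meson mult_right_mono of_nat_0_le_iff order_trans)
    then have "(\<delta>\<^sup>2 * ?b ^ Suc n) * ?b ^ n \<le> real (card ?D') * ?b ^ n"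
      by (simp add: power2_eq_square algebra_simps)
    then have "\<delta>\<^sup>2 * ?b ^ Suc n \<le> real (card ?D')" using b by (simp add: mult_le_cancel_right)
    then show "\<exists>c. good c \<and> codes c (p @ q) \<and> length (p @ q) < bnd c \<and>
          \<delta>\<^sup>2 * real (bnd c) ^ Suc n \<le> real (card {ys \<in> pts (bnd c) (Suc n). ?Q c ys})"
      using c by blast
  qed (use \<delta> in auto)
qed

section \<open>Independent copies of all coordinates\<close>

text \<open>Used with \<open>\<sigma> v\<close> equal to \<open>v\<close> or \<open>n + v\<close>,
  which selects the original or the copy of coordinate \<open>v\<close>.\<close>

definition pick :: "nat \<Rightarrow> (nat \<Rightarrow> nat) \<Rightarrow> nat list \<Rightarrow> nat list" where
  "pick n \<sigma> zs = map (\<lambda>v. zs ! \<sigma> v) [0..<n]"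

lemma length_pick [simp]: "length (pick n \<sigma> zs) = n"
  by (simp add: pick_def)

lemma pick_nth [simp]: "v < n \<Longrightarrow> pick n \<sigma> zs ! v = zs ! \<sigma> v"
  by (simp add: pick_def)

text \<open>One coordinate is copied at a time. Each copy is taken of the condition reached so far,
  which already covers all choices for the earlier coordinates, so all mixed choices are covered as
  well.\<close>

lemma large_double_aux:
  assumes "large n p Pr Q" "j \<le> n"
  shows "large (n + j) p Pr (\<lambda>c zs. \<forall>\<sigma>. (\<forall>v<n. \<sigma> v = v \<or> v < j \<and> \<sigma> v = n + v) \<longrightarrow> Q c (pick n \<sigma> zs))"
  using assms(2)
proof (induction j)
  case 0
  have "pick n \<sigma> ys = ys" if "length ys = n" "\<forall>v<n. \<sigma> v = v" for \<sigma> and ys :: "nat list"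
    using that by (intro nth_equalityI) auto
  then show ?case using assms(1) by (auto elim!: large_mono)
next
  case (Suc j)
  let ?Q = "\<lambda>j c zs. \<forall>\<sigma>. (\<forall>v<n. \<sigma> v = v \<or> v < j \<and> \<sigma> v = n + v) \<longrightarrow> Q c (pick n \<sigma> zs)"
  have "large (Suc (n + j)) p Pr (\<lambda>c zs. ?Q j c (take (n + j) zs) \<and> ?Q j c ((take (n + j) zs)[j := zs ! (n + j)]))"
    using Suc by (intro large_copy) auto
  then show ?case
    unfolding add_Suc_right
  proof (rule large_mono, intro allI impI)
    fix c zs \<sigma>
    assume len: "length zs = Suc (n + j)"
      and h: "?Q j c (take (n + j) zs) \<and> ?Q j c ((take (n + j) zs)[j := zs ! (n + j)])"
      and \<sigma>: "\<forall>v<n. \<sigma> v = v \<or> v < Suc j \<and> \<sigma> v = n + v"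
    show "Q c (pick n \<sigma> zs)"
    proof (cases "\<sigma> j = j")
      case True
      then have \<sigma>': "\<forall>v<n. \<sigma> v = v \<or> v < j \<and> \<sigma> v = n + v" using \<sigma> by (metis less_Suc_eq)
      have "pick n \<sigma> zs = pick n \<sigma> (take (n + j) zs)"
      proof (rule nth_equalityI)
        fix v assume "v < length (pick n \<sigma> zs)"
        then have v: "v < n" by simp
        then have "\<sigma> v < n + j" using \<sigma>' by (metis nat_add_left_cancel_less trans_less_add1)
        then show "pick n \<sigma> zs ! v = pick n \<sigma> (take (n + j) zs) ! v" using v by simp
      qed simp
      then show ?thesis using h \<sigma>' by simp
    next
      case False
      then have j: "\<sigma> j = n + j" using \<sigma> Suc.prems by (metis Suc_le_eq)
      \<comment> \<open>Once the newest coordinate is written into place \<open>j\<close>, choosing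
        the copy of \<open>j\<close> amounts to choosing the original.\<close>
      define \<tau> where "\<tau> = \<sigma>(j := j)"
      have \<tau>: "\<forall>v<n. \<tau> v = v \<or> v < j \<and> \<tau> v = n + v" using \<sigma> unfolding \<tau>_def by (auto simp: less_Suc_eq)
      have "pick n \<sigma> zs = pick n \<tau> ((take (n + j) zs)[j := zs ! (n + j)])"
      proof (rule nth_equalityI)
        fix v assume "v < length (pick n \<sigma> zs)"
        then have v: "v < n" by simp
        show "pick n \<sigma> zs ! v = pick n \<tau> ((take (n + j) zs)[j := zs ! (n + j)]) ! v"
        proof (cases "v = j")
          case True
          then show ?thesis using v j len by (simp add: \<tau>_def)
        next
          case False
          then have "\<sigma> v < n + j" "\<sigma> v \<noteq> j" "\<tau> v = \<sigma> v" using \<tau> v Suc.prems unfolding \<tau>_def by auto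
          then show ?thesis using v by simp
        qed
      qed simp
      then show ?thesis using h \<tau> by simp
    qed
  qed
qed

lemma large_double:
  assumes "large n p Pr Q"
  shows "large (2 * n) p Pr (\<lambda>c zs. \<forall>\<sigma>. (\<forall>v<n. \<sigma> v = v \<or> \<sigma> v = n + v) \<longrightarrow> Q c (pick n \<sigma> zs))"
proof -
  have "large (n + n) p Pr (\<lambda>c zs. \<forall>\<sigma>. (\<forall>v<n. \<sigma> v = v \<or> \<sigma> v = n + v) \<longrightarrow> Q c (pick n \<sigma> zs))"
    by (rule large_mono[OF large_double_aux[OF assms order_refl]]) blast
  then show ?thesis by (simp only: mult_2)
qed

text \<open>Finitely many tasks are met one after the other: by \<open>anti\<close>, later shrinking
  of the condition does not undo an earlier task.\<close>

lemma large_refine_finite: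
  assumes "finite A" "large n p Pr Q"
    and step: "\<And>a p Q. a \<in> A \<Longrightarrow> large n p Pr Q \<Longrightarrow>
        \<exists>q Q'. above Pr q \<and> large n (p @ q) Pr Q' \<and> (\<forall>c ys. Q' c ys \<longrightarrow> Q c ys) \<and> T a Q'"
    and anti: "\<And>a Q Q'. T a Q \<Longrightarrow> (\<forall>c ys. Q' c ys \<longrightarrow> Q c ys) \<Longrightarrow> T a Q'"
  shows "\<exists>q Q'. above Pr q \<and> large n (p @ q) Pr Q' \<and> (\<forall>c ys. Q' c ys \<longrightarrow> Q c ys) \<and> (\<forall>a\<in>A. T a Q')"
  using assms(1) step
proof (induction A)
  case empty
  show ?case using assms(2) by (intro exI[of _ "[]"] exI[of _ Q]) (simp add: above_def)
next
  case (insert a A)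
  have "\<exists>q Q'. above Pr q \<and> large n (p @ q) Pr Q' \<and> (\<forall>c ys. Q' c ys \<longrightarrow> Q c ys) \<and> (\<forall>a\<in>A. T a Q')"
    by (rule insert.IH) (use insert.prems in blast)
  then obtain q Q' where q: "above Pr q" "large n (p @ q) Pr Q'" "\<forall>c ys. Q' c ys \<longrightarrow> Q c ys" "\<forall>a\<in>A. T a Q'"
    by blast
  obtain q2 Q2 where q2: "above Pr q2" "large n ((p @ q) @ q2) Pr Q2" "\<forall>c ys. Q2 c ys \<longrightarrow> Q' c ys" "T a Q2"
    using insert.prems[OF insertI1 q(2)] by blast
  have "\<forall>b\<in>insert a A. T b Q2" using q(4) q2(3,4) anti by blast
  then show ?case
    using q q2 by (intro exI[of _ "q @ q2"] exI[of _ Q2]) (simp add: above_append)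
qed

section \<open>The measure of the caught points\<close>

lemma card_residues_le:
  fixes V :: "nat set"
  assumes "0 < K" "finite V"
  shows "card {a. a < b \<and> a mod K \<in> V} \<le> card V * (b div K + 1)"
proof -
  have "inj_on (\<lambda>a. (a mod K, a div K)) {a. a < b \<and> a mod K \<in> V}"
  proof (rule inj_onI)
    fix a a' assume "(a mod K, a div K) = (a' mod K, a' div K)"
    then show "a = a'" by (metis div_mult_mod_eq prod.inject)
  qed
  moreover have "(\<lambda>a. (a mod K, a div K)) ` {a. a < b \<and> a mod K \<in> V} \<subseteq> V \<times> {..b div K}"
    by (auto intro: div_le_mono)
  ultimately have "card {a. a < b \<and> a mod K \<in> V} \<le> card (V \<times> {..b div K})"
    using assms(2) by (intro card_inj_on_le) auto
  then show ?thesis by (simp add: card_cartesian_product)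
qed

lemma finite_slalom [simp]: "finite (slalom c k s)"
  unfolding slalom_def by simp

text \<open>With the other coordinates fixed, \<open>K\<close> and \<open>S\<close> are fixed too,
  and coordinate \<open>u\<close> has to fall into at most \<open>sqrt k\<close> residue classes
  modulo \<open>k = K ys\<close>. These form a fraction of at most \<open>2 / w\<close>; the factor
  2 pays for the incomplete last period, using \<open>k < bnd c\<close>.\<close>

lemma card_caught:
  assumes c: "good c" and u: "u < n" and w: "0 < w"
    and K: "\<And>ys a. length ys = n \<Longrightarrow> K (ys[u := a]) = K ys"
    and S: "\<And>ys a. length ys = n \<Longrightarrow> S (ys[u := a]) = S ys"
    and b: "0 < bnd c"
  shows "real (card {ys \<in> pts (bnd c) n. w * w \<le> K ys \<and> K ys < bnd c \<and> S ys < bnd c \<and>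
            ys ! u mod K ys \<in> slalom c (K ys) (S ys)}) \<le> 2 / real w * real (bnd c) ^ n"
proof -
  let ?b = "bnd c"
  let ?D = "{ys \<in> pts ?b n. w * w \<le> K ys \<and> K ys < ?b \<and> S ys < ?b \<and>
            ys ! u mod K ys \<in> slalom c (K ys) (S ys)}"
  have "card ?D * ?b \<le> (2 * ?b div w) * ?b ^ n"
  proof (rule card_small_fibres[OF u _ b])
    fix ys assume ys: "ys \<in> ?D"
    then have len: "length ys = n" using length_pts by blast
    let ?k = "K ys" and ?V = "slalom c (K ys) (S ys)"
    have "{a. a < ?b \<and> ys[u := a] \<in> ?D} \<subseteq> {a. a < ?b \<and> a mod ?k \<in> ?V}"
      using len u K S by auto
    then have "card {a. a < ?b \<and> ys[u := a] \<in> ?D} \<le> card {a. a < ?b \<and> a mod ?k \<in> ?V}"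
      by (intro card_mono) auto
    also have "\<dots> \<le> card ?V * (?b div ?k + 1)"
      using ys w by (intro card_residues_le) (auto intro: less_le_trans[of 0 "w * w"])
    finally have le: "card {a. a < ?b \<and> ys[u := a] \<in> ?D} \<le> card ?V * (?b div ?k + 1)" .
    have "(card ?V)\<^sup>2 \<le> ?k" using c ys unfolding good_def by blast
    \<comment> \<open>A slalom with at most \<open>w\<close> elements is controlled by
      \<open>w * w \<le> k\<close>, a larger one by the square bound in \<open>good\<close>.\<close>
    have "card ?V * w \<le> ?k"
    proof (cases "card ?V \<le> w")
      case True then show ?thesis using ys by (auto intro: order_trans[OF mult_le_mono1])
    next
      case False
      then have "card ?V * w \<le> card ?V * card ?V" by (intro mult_le_mono2) simp
      also have "\<dots> \<le> ?k" using \<open>(card ?V)\<^sup>2 \<le> ?k\<close> by (simp add: power2_eq_square)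
      finally show ?thesis .
    qed
    then have "card {a. a < ?b \<and> ys[u := a] \<in> ?D} * w \<le> ?k * (?b div ?k + 1)"
      using mult_le_mono1[OF le, of w] mult_le_mono1[of "card ?V * w" ?k "?b div ?k + 1"]
      by (simp add: algebra_simps)
    also have "\<dots> \<le> ?b + ?k" by simp
    also have "\<dots> \<le> 2 * ?b" using ys by simp
    finally show "card {a. a < ?b \<and> ys[u := a] \<in> ?D} \<le> 2 * ?b div w"
      using w by (simp add: less_eq_div_iff_mult_less_eq)
  qed auto
  then have "real (card ?D * ?b) \<le> real ((2 * ?b div w) * ?b ^ n)" by (rule of_nat_mono)
  then have "real (card ?D) * real ?b \<le> real (2 * ?b div w) * real ?b ^ n" by simp
  also have "\<dots> \<le> (2 * real ?b / real w) * real ?b ^ n"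
    using of_nat_div_le_of_nat[of "2 * ?b" w, where ?'a = real] by (intro mult_right_mono) auto
  finally have "real (card ?D) * real ?b \<le> (2 / real w * real ?b ^ n) * real ?b"
    by (simp add: mult.commute mult.left_commute)
  then show ?thesis using b by (simp only: mult_le_cancel_right_pos of_nat_0_less_iff)
qed

section \<open>Branches and nodes of the binary tree\<close>

text \<open>
  At stage \<open>t\<close> a point has \<open>2 ^ t\<close> coordinates, the nodes of level \<open>t\<close> of the binary tree; the
  branch \<open>x\<close> uses coordinate \<open>leaf t x\<close>.
\<close>

definition leaf :: "nat \<Rightarrow> (nat \<Rightarrow> bool) \<Rightarrow> nat" where
  "leaf t x = (\<Sum>i<t. if x i then 2 ^ i else 0)"

text \<open>The new bit is the most significant one. Thus the successors of node \<open>v\<close> of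
  level \<open>t\<close> are \<open>v\<close> and \<open>2 ^ t + v\<close>, exactly where
  \<open>large_double\<close> keeps the original and puts the copy.\<close>

lemma leaf_Suc: "leaf (Suc t) x = leaf t x + (if x t then 2 ^ t else 0)"
  by (simp add: leaf_def)

lemma leaf_less: "leaf t x < 2 ^ t"
proof (induction t)
  case 0
  show ?case by (simp add: leaf_def)
next
  case (Suc t)
  then show ?case by (simp add: leaf_Suc)
qed

lemma leaf_mod: "leaf (Suc t) x mod 2 ^ t = leaf t x"
  using leaf_less[of t x] by (simp add: leaf_Suc)

lemma leaf_eqD: "leaf t x = leaf t y \<Longrightarrow> i < t \<Longrightarrow> x i = y i"
proof (induction t)
  case (Suc t)
  have "leaf t x = leaf t y" using Suc.prems(1) leaf_mod by metis
  moreover from this have "x t = y t" using Suc.prems(1) by (auto simp: leaf_Suc split: if_splits)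
  ultimately show ?case using Suc.IH Suc.prems(2) by (cases "i = t") auto
qed simp

lemma inj_on_leaf_mono:
  assumes "inj_on (leaf t) X" "t \<le> t'"
  shows "inj_on (leaf t') X"
  using assms(2)
proof (induction t' rule: dec_induct)
  case (step t')
  show ?case
  proof (rule inj_onI)
    fix x y assume "x \<in> X" "y \<in> X" "leaf (Suc t') x = leaf (Suc t') y"
    moreover from this(3) have "leaf t' x = leaf t' y" using leaf_mod by metis
    ultimately show "x = y" using step.IH by (blast dest: inj_onD)
  qed
qed (fact assms(1))

text \<open>Each of the finitely many pairs of branches separates at its first difference
  \<open>d\<close>.\<close>

lemma inj_on_leaf_ex:
  assumes "finite X"
  shows "\<exists>t. inj_on (leaf t) X"
proof -
  define d where "d = (\<lambda>(x, y). LEAST i. x i \<noteq> (y :: nat \<Rightarrow> bool) i)"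
  define t where "t = Suc (Max (insert 0 (d ` (X \<times> X))))"
  have "inj_on (leaf t) X"
  proof (rule inj_onI, rule ccontr)
    fix x y assume h: "x \<in> X" "y \<in> X" "leaf t x = leaf t y" "x \<noteq> y"
    then obtain i where "x i \<noteq> y i" by blast
    then have ne: "x (d (x, y)) \<noteq> y (d (x, y))" unfolding d_def prod.case by (rule LeastI[of "\<lambda>i. x i \<noteq> y i" i])
    have "d (x, y) \<in> insert 0 (d ` (X \<times> X))" using h by auto
    then have "d (x, y) \<le> Max (insert 0 (d ` (X \<times> X)))" by (rule Max_ge[rotated]) (use assms in auto)
    then have "d (x, y) < t" unfolding t_def by simp
    then show False using leaf_eqD[OF h(3)] ne by blast
  qed
  then show ?thesis ..
qed

section \<open>One stage of the fusion\<close>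

definition labels :: "nat \<Rightarrow> (nat \<times> nat list) set" where
  "labels t = {..<t} \<times> {us. set us \<subseteq> {..<2 ^ t} \<and> length us \<le> t}"

lemma finite_labels: "finite (labels t)"
  unfolding labels_def by (intro finite_cartesian_product finite_lists_length_le) auto

text \<open>The least modulus at which one residue for every label of stage \<open>t\<close> is
  compatible with the square bound in \<open>adm\<close>.\<close>

definition width :: "nat \<Rightarrow> nat" where
  "width t = (card (labels t))\<^sup>2"

lemma labels_mono: "labels t \<subseteq> labels (Suc t)"
proof -
  have "(2::nat) ^ t \<le> 2 ^ Suc t" by simp
  then show ?thesis unfolding labels_def by (auto intro: less_le_trans)
qed

lemma width_mono: "width t \<le> width (Suc t)"
  unfolding width_def by (intro power_mono card_mono finite_labels labels_mono) simp

lemma width_ge: "t \<le> width t"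
proof -
  have "inj_on (\<lambda>i. (i, [])) {..<t}" by (rule inj_onI) simp
  then have "card {..<t} \<le> card (labels t)"
    by (rule card_inj_on_le) (auto simp: labels_def finite_labels[unfolded labels_def])
  then show ?thesis unfolding width_def by (simp add: power2_nat_le_imp_le order_trans[OF _ self_le_power])
qed

text \<open>The threshold \<open>m\<close> will be standard. Not being caught above some standard
  \<open>m\<close> implies escape at every nonstandard \<open>K\<close> below the bound.\<close>

definition caught :: "code \<Rightarrow> nat \<Rightarrow> nat \<Rightarrow> nat \<Rightarrow> nat \<Rightarrow> bool" where
  "caught c m K S y \<longleftrightarrow> m \<le> K \<and> K < bnd c \<and> S < bnd c \<and> y mod K \<in> slalom c K S"

context
  fixes h :: "nat \<Rightarrow> code \<Rightarrow> nat list \<Rightarrow> nat"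
begin

text \<open>The fusion works for any sequence \<open>h\<close> of functions of a code and a list of
  numbers; Skolem terms are inserted only at the end.\<close>

definition val :: "nat \<Rightarrow> nat list \<Rightarrow> code \<Rightarrow> nat list \<Rightarrow> nat" where
  "val i us c ys = h i c (map ((!) ys) us)"

definition decided :: "nat \<times> nat list \<Rightarrow> nat \<Rightarrow> (code \<Rightarrow> nat list \<Rightarrow> bool) \<Rightarrow> nat \<Rightarrow> bool" where
  "decided a k R v \<longleftrightarrow> (\<forall>c ys. R c ys \<longrightarrow> val (fst a) (snd a) c ys mod k = v)"

definition avoided :: "nat \<Rightarrow> nat \<Rightarrow> nat list \<Rightarrow> nat \<Rightarrow> (code \<Rightarrow> nat list \<Rightarrow> bool) \<Rightarrow> bool" where
  "avoided i j us u R \<longleftrightarrow> (\<exists>m. \<forall>c ys. R c ys \<longrightarrow> \<not> caught c m (val i us c ys) (val j us c ys) (ys ! u))"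

lemma large_avoid:
  assumes L: "large n p Pr Q" and u: "u < n" "u \<notin> set us"
  shows "\<exists>Q'. large n p Pr Q' \<and> (\<forall>c ys. Q' c ys \<longrightarrow> Q c ys) \<and> avoided i j us u Q'"
proof -
  have upd: "val i us c (ys[u := a]) = val i us c ys" for i c ys a
  proof -
    have "map ((!) (ys[u := a])) us = map ((!) ys) us" using u(2) by (intro map_cong refl nth_list_update_neq) blast
    then show ?thesis unfolding val_def by (rule arg_cong)
  qed
  have "\<exists>m. large n p Pr (\<lambda>c ys. Q c ys \<and> \<not> caught c (m * m) (val i us c ys) (val j us c ys) (ys ! u))"
  proof (rule large_remove[OF L])
    fix \<epsilon> :: real assume "\<epsilon> > 0"
    \<comment> \<open>Chosen so that the bound \<open>2 / w\<close> of \<open>card_caught\<close> is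
      at most \<open>\<epsilon>\<close>; the threshold for the modulus is then
      \<open>w * w\<close>.\<close>
    obtain w :: nat where w: "2 / \<epsilon> < real w" using reals_Archimedean2 by blast
    have w0: "0 < w" using w \<open>\<epsilon> > 0\<close> by (metis divide_pos_pos less_trans of_nat_0_less_iff zero_less_numeral)
    then have "2 / real w \<le> \<epsilon>" using w \<open>\<epsilon> > 0\<close> by (simp add: field_simps)
    then show "\<exists>m. \<forall>c. good c \<longrightarrow> 0 < bnd c \<longrightarrow>
        real (card {ys \<in> pts (bnd c) n. caught c (m * m) (val i us c ys) (val j us c ys) (ys ! u)})
          \<le> \<epsilon> * real (bnd c) ^ n"
      unfolding caught_def
      by (intro exI[of _ w] allI impI order_trans[OF card_caught mult_right_mono] u w0)
        (auto simp: upd)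
  qed
  then obtain m where m: "large n p Pr (\<lambda>c ys. Q c ys \<and> \<not> caught c (m * m) (val i us c ys) (val j us c ys) (ys ! u))" ..
  show ?thesis
    by (intro exI[of _ "\<lambda>c ys. Q c ys \<and> \<not> caught c (m * m) (val i us c ys) (val j us c ys) (ys ! u)"] conjI m)
      (auto simp: avoided_def)
qed

lemma large_decide_label:
  assumes L: "large n p Pr Q" and "0 < k"
  shows "\<exists>q Q'. above Pr q \<and> large n (p @ q) Pr Q' \<and> (\<forall>c ys. Q' c ys \<longrightarrow> Q c ys) \<and> (\<exists>v<k. decided a k Q' v)"
proof -
  obtain q v where "above Pr q" "v < k" "large n (p @ q) Pr (\<lambda>c ys. Q c ys \<and> val (fst a) (snd a) c ys mod k = v)"
    using large_decide[OF L, of "\<lambda>c ys. val (fst a) (snd a) c ys mod k" k] \<open>0 < k\<close> by auto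
  then show ?thesis
    by (intro exI[of _ q] exI[of _ "\<lambda>c ys. Q c ys \<and> val (fst a) (snd a) c ys mod k = v"]) (auto simp: decided_def)
qed

text \<open>
  Residues modulo \<open>k\<close> are promised only at the one stage \<open>t\<close> with \<open>width t \<le> k < width (Suc t)\<close>. It
  has few enough labels for the promise to be admissible.
\<close>

definition next_stage ::
  "nat \<Rightarrow> block \<Rightarrow> (code \<Rightarrow> nat list \<Rightarrow> bool) \<Rightarrow> block \<Rightarrow> (code \<Rightarrow> nat list \<Rightarrow> bool) \<Rightarrow> bool" where
  "next_stage t Pr Q Pr' R \<longleftrightarrow> Pr \<subseteq> Pr' \<and> (\<forall>c ys. R c ys \<longrightarrow> Q c ys) \<and>
     (\<forall>a\<in>labels t. \<forall>k. 0 < k \<longrightarrow> k < width (Suc t) \<longrightarrow>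
        (\<exists>v<k. decided a k R v \<and> (width t \<le> k \<longrightarrow> (k, v) \<in> Pr'))) \<and>
     (\<forall>i<t. \<forall>j<t. \<forall>us. length us \<le> t \<longrightarrow> set us \<subseteq> {..<2 ^ t} \<longrightarrow>
        (\<forall>u<2 ^ t. u \<notin> set us \<longrightarrow> avoided i j us u R))"

text \<open>Residues are decided while only \<open>Pr\<close> is promised, then avoidance shrinks
  the condition, and only at the end is the promise enlarged. The decisions survive because
  \<open>R\<close> implies \<open>Q1\<close>.\<close>

lemma stage:
  assumes L: "large (2 ^ t) p Pr Q" and Pr: "adm Pr" "\<forall>k v. (k, v) \<in> Pr \<longrightarrow> k < width t"
  shows "\<exists>q Pr' R. q \<noteq> [] \<and> above Pr q \<and> adm Pr' \<and> (\<forall>k v. (k, v) \<in> Pr' \<longrightarrow> k < width (Suc t)) \<and>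
     large (2 ^ t) (p @ q) Pr' R \<and> next_stage t Pr Q Pr' R"
proof -
  let ?n = "2 ^ t :: nat"
  let ?A = "labels t \<times> {0<..<width (Suc t)}"
  have "\<exists>q Q'. above Pr q \<and> large ?n (p @ q) Pr Q' \<and> (\<forall>c ys. Q' c ys \<longrightarrow> Q c ys) \<and>
      (\<forall>x\<in>?A. \<exists>v<snd x. decided (fst x) (snd x) Q' v)"
  proof (rule large_refine_finite[OF _ L])
    show "finite ?A" using finite_labels by simp
  next
    fix x p Q assume "x \<in> ?A" "large ?n p Pr Q"
    then show "\<exists>q Q'. above Pr q \<and> large ?n (p @ q) Pr Q' \<and> (\<forall>c ys. Q' c ys \<longrightarrow> Q c ys) \<and>
      (\<exists>v<snd x. decided (fst x) (snd x) Q' v)"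
      by (intro large_decide_label) auto
  next
    fix x Q Q' assume "\<exists>v<snd x. decided (fst x) (snd x) Q v" "\<forall>c ys. Q' c ys \<longrightarrow> Q c ys"
    then show "\<exists>v<snd x. decided (fst x) (snd x) Q' v" unfolding decided_def by meson
  qed
  then obtain q1 Q1 where q1: "above Pr q1" "large ?n (p @ q1) Pr Q1" "\<forall>c ys. Q1 c ys \<longrightarrow> Q c ys"
    and dec: "\<And>a k. a \<in> labels t \<Longrightarrow> 0 < k \<Longrightarrow> k < width (Suc t) \<Longrightarrow> \<exists>v<k. decided a k Q1 v"
    by fastforce
  let ?B = "{..<t} \<times> {..<t} \<times> {us. set us \<subseteq> {..<?n} \<and> length us \<le> t} \<times> {..<?n}"
  let ?T = "\<lambda>(i, j, us, u) R. u \<notin> set us \<longrightarrow> avoided i j us u R"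
  have "\<exists>q Q'. above Pr q \<and> large ?n ((p @ q1) @ q) Pr Q' \<and> (\<forall>c ys. Q' c ys \<longrightarrow> Q1 c ys) \<and> (\<forall>x\<in>?B. ?T x Q')"
  proof (rule large_refine_finite[OF _ q1(2)])
    show "finite ?B" by (intro finite_cartesian_product finite_lists_length_le) auto
  next
    fix x p Q assume x: "x \<in> ?B" and l: "large ?n p Pr Q"
    obtain i j us u where xe: "x = (i, j, us, u)" by (metis prod_cases4)
    show "\<exists>q Q'. above Pr q \<and> large ?n (p @ q) Pr Q' \<and> (\<forall>c ys. Q' c ys \<longrightarrow> Q c ys) \<and> ?T x Q'"
    proof (cases "u \<in> set us")
      case True
      then show ?thesis using l xe by (intro exI[of _ "[]"] exI[of _ Q]) (simp add: above_def)
    next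
      case False
      then obtain Q' where "large ?n p Pr Q'" "\<forall>c ys. Q' c ys \<longrightarrow> Q c ys" "avoided i j us u Q'"
        using large_avoid[OF l, of u us i j] x xe by auto
      then show ?thesis using xe by (intro exI[of _ "[]"] exI[of _ Q']) (simp add: above_def)
    qed
  next
    fix x Q Q' assume "?T x Q" "\<forall>c ys. Q' c ys \<longrightarrow> Q c ys"
    then show "?T x Q'" unfolding avoided_def by (auto split: prod.splits) blast
  qed
  then obtain q2 R where q2: "above Pr q2" "large ?n ((p @ q1) @ q2) Pr R" "\<forall>c ys. R c ys \<longrightarrow> Q1 c ys"
    and av: "\<forall>x\<in>?B. ?T x R" by blast
  \<comment> \<open>The extra block \<open>Pr\<close> respects the promise and ensures that
    \<open>q\<close> is not empty, so that the length grows at every stage.\<close>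
  define q where "q = q1 @ q2 @ [Pr]"
  have aPr: "above Pr [Pr]" using Pr(1) by (simp add: above_def)
  have q: "above Pr q" using q1 q2 aPr unfolding q_def by (simp add: above_append)
  have Lq: "large ?n (p @ q) Pr R" using large_append[OF q2(2) aPr] unfolding q_def by simp
  define v where "v = (\<lambda>a k. SOME v. v < k \<and> decided a k Q1 v)"
  have v: "v a k < k \<and> decided a k Q1 (v a k)" if "a \<in> labels t" "0 < k" "k < width (Suc t)" for a k
    unfolding v_def by (rule someI_ex) (use dec that in blast)
  define New where "New = (\<lambda>(a, k). (k, v a k)) ` (labels t \<times> {k. 0 < k \<and> width t \<le> k \<and> k < width (Suc t)})"
  define Pr' where "Pr' = Pr \<union> New"
  have finNew: "finite New" unfolding New_def using finite_labels by (intro finite_imageI finite_cartesian_product) auto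
  have New: "(k, w) \<in> New \<longleftrightarrow> 0 < k \<and> width t \<le> k \<and> k < width (Suc t) \<and> w \<in> (\<lambda>a. v a k) ` labels t" for k w
    unfolding New_def by auto
  have "adm Pr'"
    unfolding adm_def
  proof (intro conjI allI impI)
    show "finite Pr'" unfolding Pr'_def using Pr(1) finNew by (simp add: adm_def)
  next
    fix k w assume "(k, w) \<in> Pr'"
    then show "w < k" unfolding Pr'_def using Pr(1) v by (auto simp: New adm_def)
  next
    fix k
    show "(card {r. (k, r) \<in> Pr'})\<^sup>2 \<le> k"
    proof (cases "width t \<le> k")
      case True
      \<comment> \<open>The old promise concerns only moduli below \<open>width t\<close>, so at
        \<open>k\<close> there is at most one residue for each label.\<close>
      have "{r. (k, r) \<in> Pr'} \<subseteq> (\<lambda>a. v a k) ` labels t"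
        unfolding Pr'_def using Pr(2) True by (force simp: New)
      then have "card {r. (k, r) \<in> Pr'} \<le> card (labels t)"
        using finite_labels by (meson card_image_le card_mono finite_imageI order_trans)
      then have "(card {r. (k, r) \<in> Pr'})\<^sup>2 \<le> width t" unfolding width_def by (rule power_mono) simp
      then show ?thesis using True by simp
    next
      case False
      then have "{r. (k, r) \<in> Pr'} = {r. (k, r) \<in> Pr}" unfolding Pr'_def by (auto simp: New)
      then show ?thesis using Pr(1) by (simp add: adm_def)
    qed
  qed
  moreover have "k < width (Suc t)" if "(k, w) \<in> Pr'" for k w
    using that Pr(2) width_mono[of t] unfolding Pr'_def by (auto simp: New intro: less_le_trans)
  moreover have "large ?n (p @ q) Pr' R" using Lq by (rule large_promise) (simp add: Pr'_def)
  moreover have "next_stage t Pr Q Pr' R"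
    unfolding next_stage_def
  proof (intro conjI ballI allI impI)
    show "Pr \<subseteq> Pr'" by (simp add: Pr'_def)
  next
    fix c ys assume "R c ys" then show "Q c ys" using q1 q2 by blast
  next
    fix a k assume a: "a \<in> labels t" "0 < k" "k < width (Suc t)"
    have "decided a k R (v a k)" using v[OF a] q2(3) unfolding decided_def by blast
    moreover have "width t \<le> k \<longrightarrow> (k, v a k) \<in> Pr'" using a unfolding Pr'_def by (auto simp: New)
    ultimately show "\<exists>v<k. decided a k R v \<and> (width t \<le> k \<longrightarrow> (k, v) \<in> Pr')" using v[OF a] by blast
  next
    fix i j u and us :: "nat list" assume "i < t" "j < t" "length us \<le> t" "set us \<subseteq> {..<2 ^ t}" "u < 2 ^ t" "u \<notin> set us"
    then have "(i, j, us, u) \<in> ?B" by simp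
    then show "avoided i j us u R" using av \<open>u \<notin> set us\<close> by blast
  qed
  moreover have "q \<noteq> []" by (simp add: q_def)
  ultimately show ?thesis using q by blast
qed

section \<open>Iteration of the stages\<close>

text \<open>Dependent choice. The condition for level \<open>t + 1\<close> consists of the vectors
  of double length for which every selection of one successor per node lies in
  \<open>R\<close>.\<close>

lemma stages:
  "\<exists>p Pr Q. \<forall>t. large (2 ^ t) (p t) (Pr t) (Q t) \<and>
     (\<exists>q R. q \<noteq> [] \<and> above (Pr t) q \<and> p (Suc t) = p t @ q \<and> next_stage t (Pr t) (Q t) (Pr (Suc t)) R \<and>
       (\<forall>c zs \<sigma>. Q (Suc t) c zs \<longrightarrow> (\<forall>v<2 ^ t. \<sigma> v = v \<or> \<sigma> v = 2 ^ t + v) \<longrightarrow> R c (pick (2 ^ t) \<sigma> zs)))"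
proof -
  let ?P = "\<lambda>t (p, Pr, Q). large (2 ^ t) p Pr Q \<and> adm Pr \<and> (\<forall>k v. (k, v) \<in> Pr \<longrightarrow> k < width t)"
  let ?S = "\<lambda>t (p, Pr, Q) (p', Pr', Q'). \<exists>q R. q \<noteq> [] \<and> above Pr q \<and> p' = p @ q \<and> next_stage t Pr Q Pr' R \<and>
       (\<forall>c zs \<sigma>. Q' c zs \<longrightarrow> (\<forall>v<2 ^ t. \<sigma> v = v \<or> \<sigma> v = 2 ^ t + v) \<longrightarrow> R c (pick (2 ^ t) \<sigma> zs))"
  have "\<exists>f. \<forall>t. ?P t (f t) \<and> ?S t (f t) (f (Suc t))"
  proof (rule dependent_nat_choice)
    have "?P 0 ([], {}, \<lambda>_ _. True)" using large_init by (simp add: adm_def)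
    then show "\<exists>x. ?P 0 x" ..
  next
    fix x t assume P: "?P t x"
    obtain p Pr Q where x: "x = (p, Pr, Q)" by (metis prod_cases3)
    from P have L: "large (2 ^ t) p Pr Q" "adm Pr" "\<forall>k v. (k, v) \<in> Pr \<longrightarrow> k < width t"
      unfolding x by auto
    obtain q Pr' R where
      q: "q \<noteq> []" "above Pr q" "adm Pr'" "\<forall>k v. (k, v) \<in> Pr' \<longrightarrow> k < width (Suc t)"
        "large (2 ^ t) (p @ q) Pr' R" "next_stage t Pr Q Pr' R"
      using stage[OF L] by (elim exE conjE) (rule that)
    define Q' where "Q' = (\<lambda>c zs. \<forall>\<sigma>. (\<forall>v<2 ^ t. \<sigma> v = v \<or> \<sigma> v = 2 ^ t + v) \<longrightarrow> R c (pick (2 ^ t) \<sigma> zs))"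
    have "large (2 ^ Suc t) (p @ q) Pr' Q'"
      unfolding Q'_def power_Suc by (rule large_double[OF q(5)])
    then have "?P (Suc t) (p @ q, Pr', Q') \<and> ?S t x (p @ q, Pr', Q')"
      using q unfolding x Q'_def by auto
    then show "\<exists>y. ?P (Suc t) y \<and> ?S t x y" by blast
  qed
  then obtain f where f: "\<forall>t. ?P t (f t) \<and> ?S t (f t) (f (Suc t))" ..
  show ?thesis
    by (rule exI[of _ "\<lambda>t. fst (f t)"], rule exI[of _ "\<lambda>t. fst (snd (f t))"], rule exI[of _ "\<lambda>t. snd (snd (f t))"])
      (use f in \<open>simp add: case_prod_beta\<close>)
qed

text \<open>\<open>C t\<close> and \<open>Y t\<close> are any witnesses of the condition of stage
  \<open>t\<close>. Along branches separated at level \<open>t\<close>, all later witnesses restrict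
  to points of \<open>R t\<close>, so what stage \<open>t\<close> enforces on \<open>R t\<close>
  holds for all \<open>T > t\<close>.\<close>

theorem fusion:
  "\<exists>C Y. (\<forall>t. t \<le> bnd (C t)) \<and>
    (\<forall>i xs k. 0 < k \<longrightarrow> (\<exists>v. \<forall>\<^sub>F t in sequentially.
        h i (C t) (map (\<lambda>x. Y t ! leaf t x) xs) mod k = v)) \<and>
    (\<forall>i xs. \<exists>k0. \<forall>k\<ge>k0. \<exists>s0. \<forall>s\<ge>s0. \<forall>\<^sub>F t in sequentially.
        h i (C t) (map (\<lambda>x. Y t ! leaf t x) xs) mod k \<in> slalom (C t) k s) \<and>
    (\<forall>i j xs x. x \<notin> set xs \<longrightarrow> (\<exists>m. \<forall>\<^sub>F t in sequentially.
        \<not> caught (C t) m (h i (C t) (map (\<lambda>x. Y t ! leaf t x) xs))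
           (h j (C t) (map (\<lambda>x. Y t ! leaf t x) xs)) (Y t ! leaf t x)))"
proof -
  obtain p Pr Q where L: "\<And>t. large (2 ^ t) (p t) (Pr t) (Q t)"
    and N: "\<And>t. \<exists>q R. q \<noteq> [] \<and> above (Pr t) q \<and> p (Suc t) = p t @ q \<and> next_stage t (Pr t) (Q t) (Pr (Suc t)) R \<and>
       (\<forall>c zs \<sigma>. Q (Suc t) c zs \<longrightarrow> (\<forall>v<2 ^ t. \<sigma> v = v \<or> \<sigma> v = 2 ^ t + v) \<longrightarrow> R c (pick (2 ^ t) \<sigma> zs))"
    using stages by metis
  obtain q R where q: "\<And>t. q t \<noteq> []" "\<And>t. above (Pr t) (q t)" "\<And>t. p (Suc t) = p t @ q t"
    and R: "\<And>t. next_stage t (Pr t) (Q t) (Pr (Suc t)) (R t)"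
    and dup: "\<And>t c zs \<sigma>. Q (Suc t) c zs \<Longrightarrow> (\<forall>v<2 ^ t. \<sigma> v = v \<or> \<sigma> v = 2 ^ t + v) \<Longrightarrow> R t c (pick (2 ^ t) \<sigma> zs)"
    using N by metis
  have "\<exists>c ys. good c \<and> codes c (p t) \<and> length (p t) < bnd c \<and> ys \<in> pts (bnd c) (2 ^ t) \<and> Q t c ys" for t
    by (rule large_nonempty[OF L])
  then obtain C Y where C: "\<And>t. codes (C t) (p t)" "\<And>t. length (p t) < bnd (C t)"
    and Y: "\<And>t. Q t (C t) (Y t)" by metis
  have len: "t \<le> length (p t)" for t
  proof (induction t)
    case (Suc t)
    then show ?case using q(1)[of t] q(3)[of t] by (cases "q t") auto
  qed simp
  have "Pr t \<subseteq> Pr (Suc t)" for t using R[of t] unfolding next_stage_def by blast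
  then have Prmono: "Pr t \<subseteq> Pr t'" if "t \<le> t'" for t t'
    using that by (rule lift_Suc_mono_le)
  \<comment> \<open>Blocks with index at least \<open>length (p t)\<close> are appended at stage
    \<open>t\<close> or later, so they contain \<open>Pr t\<close>. This length serves as the
    threshold \<open>s0\<close> below.\<close>
  have promise: "(k, v) \<in> Pr t \<Longrightarrow> length (p t) \<le> s \<Longrightarrow> \<forall>\<^sub>F T in sequentially. v \<in> slalom (C T) k s" for k v t s
  proof -
    assume kv: "(k, v) \<in> Pr t" and s: "length (p t) \<le> s"
    have blk: "(k, v) \<in> p T ! s" if "t \<le> T" "s < length (p T)" for T
      using that
    proof (induction T rule: dec_induct)
      case base then show ?case using s by simp
    next
      case (step T)
      show ?case
      proof (cases "s < length (p T)")
        case True then show ?thesis using step q(3)[of T] by (simp add: nth_append)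
      next
        case False
        then have "p (Suc T) ! s \<in> set (q T)" using step.prems q(3)[of T] by (simp add: nth_append)
        then have "Pr T \<subseteq> p (Suc T) ! s" using q(2)[of T] unfolding above_def by blast
        then show ?thesis using Prmono[OF step.hyps(1)] kv by blast
      qed
    qed
    have "v \<in> slalom (C T) k s" if "max t (Suc s) \<le> T" for T
    proof -
      have sT: "s < length (p T)" using that len[of T] by simp
      then have "(k, v) \<in> p T ! s" using blk that by simp
      then show ?thesis using C(1)[of T] sT unfolding codes_def by blast
    qed
    then show ?thesis unfolding eventually_sequentially by blast
  qed
  have down: "\<exists>ys'. R t c ys' \<and> (\<forall>x\<in>X. ys' ! leaf t x = ys ! leaf T x)"
    if "Suc t \<le> T" "inj_on (leaf t) X" "Q T c ys" for t T X c ys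
  proof -
    have one: "\<exists>ys'. R T c ys' \<and> (\<forall>x\<in>X. ys' ! leaf T x = ys ! leaf (Suc T) x)"
      if "inj_on (leaf T) X" "Q (Suc T) c ys" for T ys
    proof -
      \<comment> \<open>Moves a node to its copy if a branch of \<open>X\<close> turns right there.
        Injectivity of \<open>leaf T\<close> on \<open>X\<close> excludes that two branches of
        \<open>X\<close> leave one node in different directions.\<close>
      define \<sigma> where "\<sigma> = (\<lambda>v. if v \<in> leaf T ` {x \<in> X. x T} then 2 ^ T + v else v)"
      have "R T c (pick (2 ^ T) \<sigma> ys)" using that(2) by (rule dup) (auto simp: \<sigma>_def)
      moreover have "pick (2 ^ T) \<sigma> ys ! leaf T x = ys ! leaf (Suc T) x" if "x \<in> X" for x
      proof -
        have "leaf T x \<in> leaf T ` {x \<in> X. x T} \<longleftrightarrow> x T"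
          using \<open>inj_on (leaf T) X\<close> that unfolding inj_on_def by blast
        then have "\<sigma> (leaf T x) = leaf (Suc T) x" unfolding \<sigma>_def leaf_Suc by simp
        then show ?thesis using leaf_less by simp
      qed
      ultimately show ?thesis by blast
    qed
    note tX = that(2)
    show ?thesis using that(1,3)
    proof (induction T arbitrary: ys rule: dec_induct)
      case base then show ?case using one[OF tX] by blast
    next
      case (step T)
      have "inj_on (leaf T) X" using inj_on_leaf_mono[OF tX] step.hyps by simp
      then obtain ys' where ys': "R T c ys'" "\<forall>x\<in>X. ys' ! leaf T x = ys ! leaf (Suc T) x"
        using one step.prems by blast
      have "Q T c ys'" using R[of T] ys'(1) unfolding next_stage_def by blast
      then obtain ys'' where "R t c ys''" "\<forall>x\<in>X. ys'' ! leaf t x = ys' ! leaf T x" using step.IH by blast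
      then show ?case using ys'(2) by (intro exI[of _ ys'']) simp
    qed
  qed
  have tr: "\<exists>ys'. R t (C T) ys' \<and> (\<forall>x\<in>X. ys' ! leaf t x = Y T ! leaf T x) \<and>
      (\<forall>i xs. set xs \<subseteq> X \<longrightarrow> val i (map (leaf t) xs) (C T) ys' = h i (C T) (map (\<lambda>x. Y T ! leaf T x) xs))"
    if tT: "Suc t \<le> T" "inj_on (leaf t) X" for t T X
  proof -
    obtain ys' where ys': "R t (C T) ys'" "\<forall>x\<in>X. ys' ! leaf t x = Y T ! leaf T x" using down[OF tT Y] by blast
    have mp: "map ((!) ys') (map (leaf t) xs) = map (\<lambda>x. Y T ! leaf T x) xs" if "set xs \<subseteq> X" for xs
      using ys'(2) that by auto
    show ?thesis
    proof (intro exI[of _ ys'] conjI ys' allI impI)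
      fix i xs assume "set xs \<subseteq> X"
      then show "val i (map (leaf t) xs) (C T) ys' = h i (C T) (map (\<lambda>x. Y T ! leaf T x) xs)"
        unfolding val_def by (simp only: mp)
    qed
  qed
  have decT: "h i (C T) (map (\<lambda>x. Y T ! leaf T x) xs) mod k = v"
    if d: "decided (i, map (leaf t) xs) k (R t) v" and inj: "inj_on (leaf t) (set xs)" and T: "Suc t \<le> T" for i t T xs k v
  proof -
    obtain ys' where ys': "R t (C T) ys'"
      "val i (map (leaf t) xs) (C T) ys' = h i (C T) (map (\<lambda>x. Y T ! leaf T x) xs)"
      using tr[OF T inj] by blast
    have "val i (map (leaf t) xs) (C T) ys' mod k = v"
      using d ys'(1) unfolding decided_def fst_conv snd_conv by blast
    then show ?thesis unfolding ys'(2) .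
  qed
  have lab: "(i, map (leaf t) xs) \<in> labels t" if "i < t" "length xs \<le> t" for i xs t
    using that leaf_less unfolding labels_def by auto
  show ?thesis
  proof (intro exI[of _ C] exI[of _ Y] conjI allI impI)
    fix t show "t \<le> bnd (C t)" using C(2)[of t] len[of t] by simp
  next
    fix i xs and k :: nat assume k: "0 < k"
    obtain t0 where t0: "inj_on (leaf t0) (set xs)" using inj_on_leaf_ex by blast
    define t where "t = Max {t0, Suc i, length xs, k}"
    have t: "t0 \<le> t" "i < t" "length xs \<le> t" "k \<le> t" unfolding t_def by auto
    have inj: "inj_on (leaf t) (set xs)" using inj_on_leaf_mono[OF t0 t(1)] .
    have "k < width (Suc t)" using t(4) width_ge[of "Suc t"] by simp
    then obtain v where v: "decided (i, map (leaf t) xs) k (R t) v"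
      using R[of t] lab[OF t(2,3)] k unfolding next_stage_def by blast
    have "h i (C T) (map (\<lambda>x. Y T ! leaf T x) xs) mod k = v" if "Suc t \<le> T" for T
      using decT[OF v inj that] .
    then show "\<exists>v. \<forall>\<^sub>F t in sequentially. h i (C t) (map (\<lambda>x. Y t ! leaf t x) xs) mod k = v"
      unfolding eventually_sequentially by blast
  next
    fix i xs
    obtain t0 where t0: "inj_on (leaf t0) (set xs)" using inj_on_leaf_ex by blast
    define t1 where "t1 = Max {t0, Suc i, length xs}"
    have t1: "t0 \<le> t1" "i < t1" "length xs \<le> t1" unfolding t1_def by auto
    show "\<exists>k0. \<forall>k\<ge>k0. \<exists>s0. \<forall>s\<ge>s0. \<forall>\<^sub>F t in sequentially.
        h i (C t) (map (\<lambda>x. Y t ! leaf t x) xs) mod k \<in> slalom (C t) k s"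
    \<comment> \<open>Moduli above this threshold are positive and belong to a stage not before
      \<open>t1\<close>, when the label is already treated and its branches are separated.\<close>
    proof (rule exI[of _ "Suc (width t1)"], intro allI impI)
      fix k assume k: "Suc (width t1) \<le> k"
      \<comment> \<open>The only stage whose new promises concern the modulus
        \<open>k\<close>.\<close>
      define t where "t = (GREATEST t. width t \<le> k)"
      have bd: "t \<le> k" if "width t \<le> k" for t using that width_ge[of t] by simp
      have wt: "width t \<le> k" unfolding t_def by (rule GreatestI_nat[of _ t1 k]) (use k bd in auto)
      have "t1 \<le> t" unfolding t_def by (rule Greatest_le_nat[of _ t1 k]) (use k bd in auto)
      have "\<not> width (Suc t) \<le> k"
      proof
        assume "width (Suc t) \<le> k"
        then have "Suc t \<le> t" unfolding t_def by (intro Greatest_le_nat[of _ _ k]) (use bd in auto)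
        then show False by simp
      qed
      then have kt: "k < width (Suc t)" by simp
      have t: "t0 \<le> t" "i < t" "length xs \<le> t" using t1 \<open>t1 \<le> t\<close> by auto
      have inj: "inj_on (leaf t) (set xs)" using inj_on_leaf_mono[OF t0 t(1)] .
      obtain v where v: "decided (i, map (leaf t) xs) k (R t) v" "(k, v) \<in> Pr (Suc t)"
        using R[of t] lab[OF t(2,3)] k kt wt unfolding next_stage_def
        by (metis Suc_le_D zero_less_Suc)
      have "h i (C T) (map (\<lambda>x. Y T ! leaf T x) xs) mod k = v" if "Suc t \<le> T" for T
        using decT[OF v(1) inj that] .
      then have ev: "\<forall>\<^sub>F T in sequentially. h i (C T) (map (\<lambda>x. Y T ! leaf T x) xs) mod k = v"
        unfolding eventually_sequentially by blast
      show "\<exists>s0. \<forall>s\<ge>s0. \<forall>\<^sub>F t in sequentially.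
          h i (C t) (map (\<lambda>x. Y t ! leaf t x) xs) mod k \<in> slalom (C t) k s"
      proof (intro exI[of _ "length (p (Suc t))"] allI impI)
        fix s assume "length (p (Suc t)) \<le> s"
        from eventually_conj[OF ev promise[OF v(2) this]]
        show "\<forall>\<^sub>F t in sequentially. h i (C t) (map (\<lambda>x. Y t ! leaf t x) xs) mod k \<in> slalom (C t) k s"
          by (rule eventually_mono) auto
      qed
    qed
  next
    fix i j xs and x :: "nat \<Rightarrow> bool" assume x: "x \<notin> set xs"
    obtain t0 where t0: "inj_on (leaf t0) (insert x (set xs))" using inj_on_leaf_ex by blast
    define t where "t = Max {t0, Suc i, Suc j, length xs}"
    have t: "t0 \<le> t" "i < t" "j < t" "length xs \<le> t" unfolding t_def by auto
    have inj: "inj_on (leaf t) (insert x (set xs))" using inj_on_leaf_mono[OF t0 t(1)] .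
    \<comment> \<open>Level \<open>t\<close> separates \<open>x\<close> from the arguments, so the
      number at \<open>x\<close> is a coordinate on which the two function values do not
      depend.\<close>
    have "leaf t x \<notin> set (map (leaf t) xs)" using inj x unfolding inj_on_def by auto
    moreover have "length (map (leaf t) xs) \<le> t" "set (map (leaf t) xs) \<subseteq> {..<2 ^ t}"
      using t(4) leaf_less by auto
    ultimately have "avoided i j (map (leaf t) xs) (leaf t x) (R t)"
      using R[of t, unfolded next_stage_def, THEN conjunct2, THEN conjunct2, THEN conjunct2, rule_format,
          OF t(2,3) _ _ leaf_less] by blast
    then obtain m where m: "\<And>c ys. R t c ys \<Longrightarrow>
        \<not> caught c m (val i (map (leaf t) xs) c ys) (val j (map (leaf t) xs) c ys) (ys ! leaf t x)"
      unfolding avoided_def by blast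
    have "\<not> caught (C T) m (h i (C T) (map (\<lambda>x. Y T ! leaf T x) xs))
           (h j (C T) (map (\<lambda>x. Y T ! leaf T x) xs)) (Y T ! leaf T x)" if tT: "Suc t \<le> T" for T
    proof -
      obtain ys' where "R t (C T) ys'" "ys' ! leaf t x = Y T ! leaf T x"
        "\<And>i. val i (map (leaf t) xs) (C T) ys' = h i (C T) (map (\<lambda>x. Y T ! leaf T x) xs)"
        using tr[OF tT inj] by (metis insertI1 subset_insertI)
      then show ?thesis using m by metis
    qed
    then show "\<exists>m. \<forall>\<^sub>F t in sequentially.
        \<not> caught (C t) m (h i (C t) (map (\<lambda>x. Y t ! leaf t x) xs))
           (h j (C t) (map (\<lambda>x. Y t ! leaf t x) xs)) (Y t ! leaf t x)"
      unfolding eventually_sequentially by blast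
  qed
qed

end

section \<open>The model\<close>

text \<open>\<open>Par\<close> and, in \<open>nsat\<close>, \<open>InP\<close> get dummy values. As
  parameters are ignored, \<open>nsat\<close> does not change when they are all replaced by
  \<open>()\<close>, which yields a countable type of formulas.\<close>

primrec neval :: "(nat \<Rightarrow> nat) \<Rightarrow> 'a trm \<Rightarrow> nat" where
  "neval e (Var i) = e i"
| "neval e (Par a) = 0"
| "neval e Zero = 0"
| "neval e One = 1"
| "neval e (Add s t) = neval e s + neval e t"
| "neval e (Mul s t) = neval e s * neval e t"

primrec nsat :: "(nat \<Rightarrow> nat) \<Rightarrow> 'a fm \<Rightarrow> bool" where
  "nsat e (Eq s t) \<longleftrightarrow> neval e s = neval e t"
| "nsat e (Less s t) \<longleftrightarrow> neval e s < neval e t"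
| "nsat e (InP t) \<longleftrightarrow> False"
| "nsat e (Neg \<phi>) \<longleftrightarrow> \<not> nsat e \<phi>"
| "nsat e (Conj \<phi> \<psi>) \<longleftrightarrow> nsat e \<phi> \<and> nsat e \<psi>"
| "nsat e (Forall \<phi>) \<longleftrightarrow> (\<forall>a. nsat (case_nat a e) \<phi>)"

lemma neval_subst: "neval e (subst_trm \<sigma> t) = neval (\<lambda>i. neval e (\<sigma> i)) t"
  by (induction t) auto

lemma neval_lift_subst:
  "(\<lambda>i. neval (case_nat a e) (lift_subst \<sigma> i)) = case_nat a (\<lambda>i. neval e (\<sigma> i))"
proof
  fix i show "neval (case_nat a e) (lift_subst \<sigma> i) = case_nat a (\<lambda>i. neval e (\<sigma> i)) i"
    by (cases i) (simp_all add: lift_subst_def neval_subst)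
qed

lemma nsat_subst: "nsat e (subst_fm \<sigma> \<phi>) \<longleftrightarrow> nsat (\<lambda>i. neval e (\<sigma> i)) \<phi>"
  by (induction \<phi> arbitrary: e \<sigma>) (simp_all only: subst_fm.simps nsat.simps neval_subst neval_lift_subst)

lemma neval_cong:
  assumes "\<And>i. i < n \<Longrightarrow> e i = e' i"
  shows "closed_trm n t \<Longrightarrow> neval e t = neval e' t"
  by (induction t) (use assms in simp_all)

lemma nsat_cong:
  "closed_fm n \<phi> \<Longrightarrow> \<forall>i<n. e i = e' i \<Longrightarrow> nsat e \<phi> \<longleftrightarrow> nsat e' \<phi>"
proof (induction \<phi> arbitrary: n e e')
  case (Forall \<phi>)
  have "nsat (case_nat a e) \<phi> \<longleftrightarrow> nsat (case_nat a e') \<phi>" for a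
  proof (rule Forall.IH[of "Suc n"])
    show "closed_fm (Suc n) \<phi>" using Forall.prems(1) by simp
    show "\<forall>i<Suc n. case_nat a e i = case_nat a e' i" using Forall.prems(2) by (auto simp: less_Suc_eq_0_disj)
  qed
  then show ?case by simp
next
  case (Neg \<phi>)
  have "closed_fm n \<phi>" using Neg.prems(1) by simp
  from Neg.IH[OF this Neg.prems(2)] show ?case by simp
next
  case (Conj \<phi> \<psi>)
  have "closed_fm n \<phi>" "closed_fm n \<psi>" using Conj.prems(1) by simp_all
  from Conj.IH(1)[OF this(1) Conj.prems(2)] Conj.IH(2)[OF this(2) Conj.prems(2)] show ?case by simp
next
  case (Eq s t)
  have "closed_trm n s" "closed_trm n t" using Eq.prems(1) by simp_all
  with neval_cong[of n e e'] Eq.prems(2) show ?case by (metis nsat.simps(1))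
next
  case (Less s t)
  have "closed_trm n s" "closed_trm n t" using Less.prems(1) by simp_all
  with neval_cong[of n e e'] Less.prems(2) show ?case by (metis nsat.simps(2))
qed simp

lemma closed_trm_mono: "closed_trm n t \<Longrightarrow> n \<le> m \<Longrightarrow> closed_trm m t"
  by (induction t) auto

lemma closed_fm_mono: "closed_fm n \<phi> \<Longrightarrow> n \<le> m \<Longrightarrow> closed_fm m \<phi>"
proof (induction \<phi> arbitrary: n m)
  case (Forall \<phi>)
  then show ?case using Forall.IH[of "Suc n" "Suc m"] by simp
next
  case (Conj \<phi> \<psi>)
  then show ?case using Conj.IH(1)[of n m] Conj.IH(2)[of n m] by simp
next
  case (Neg \<phi>)
  then show ?case using Neg.IH[of n m] by simp
next
  case (Eq s t)
  then show ?case using closed_trm_mono[of n s m] closed_trm_mono[of n t m] by simp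
next
  case (Less s t)
  then show ?case using closed_trm_mono[of n s m] closed_trm_mono[of n t m] by simp
next
  case (InP t)
  then show ?case using closed_trm_mono[of n t m] by simp
qed

lemma closed_trm_ex: "\<exists>n. closed_trm n t"
proof (induction t)
  case (Var i)
  show ?case by (rule exI[of _ "Suc i"]) simp
next
  case (Add s t)
  then obtain n m where "closed_trm n s" "closed_trm m t" by blast
  then have "closed_trm (max n m) (Add s t)" by (auto intro: closed_trm_mono)
  then show ?case ..
next
  case (Mul s t)
  then obtain n m where "closed_trm n s" "closed_trm m t" by blast
  then have "closed_trm (max n m) (Mul s t)" by (auto intro: closed_trm_mono)
  then show ?case ..
qed auto

lemma closed_fm_ex: "\<exists>n. closed_fm n \<phi>"
proof (induction \<phi>)
  case (Eq s t)
  obtain n m where "closed_trm n s" "closed_trm m t" using closed_trm_ex by metis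
  then have "closed_fm (max n m) (Eq s t)" by (auto intro: closed_trm_mono)
  then show ?case ..
next
  case (Less s t)
  obtain n m where "closed_trm n s" "closed_trm m t" using closed_trm_ex by metis
  then have "closed_fm (max n m) (Less s t)" by (auto intro: closed_trm_mono)
  then show ?case ..
next
  case (Conj \<phi> \<psi>)
  then obtain n m where "closed_fm n \<phi>" "closed_fm m \<psi>" by blast
  then have "closed_fm (max n m) (Conj \<phi> \<psi>)" by (auto intro: closed_fm_mono)
  then show ?case ..
next
  case (Forall \<phi>)
  then obtain n where "closed_fm n \<phi>" by blast
  then have "closed_fm n (Forall \<phi>)" by (auto intro: closed_fm_mono)
  then show ?case ..
qed (auto simp: closed_trm_ex)

lemma neval_map: "neval e (map_trm f t) = neval e t"
  by (induction t) auto

lemma nsat_map: "nsat e (map_fm f \<phi>) \<longleftrightarrow> nsat e \<phi>"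
  by (induction \<phi> arbitrary: e) (auto simp: neval_map)

lemma PA_true:
  assumes "\<phi> \<in> PA"
  shows "nsat e \<phi>"
proof -
  have "nsat e (induction_axiom \<psi>)" for \<psi> :: "'a fm"
  proof -
    let ?e = "\<lambda>n. case_nat n e"
    have z: "(\<lambda>i. neval e (case_nat Zero Var i)) = ?e 0"
      by (rule ext) (auto split: nat.split)
    have s: "(\<lambda>i. neval (?e a) (case_nat (Add (Var 0) One) (\<lambda>i. Var (Suc i)) i)) = ?e (Suc a)" for a
      by (rule ext) (auto split: nat.split)
    have "\<forall>a. nsat (?e a) \<psi>" if "nsat (?e 0) \<psi>" "\<forall>a. nsat (?e a) \<psi> \<longrightarrow> nsat (?e (Suc a)) \<psi>"
      using that nat_induct[of "\<lambda>a. nsat (?e a) \<psi>"] by blast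
    then show ?thesis unfolding induction_axiom_def nsat.simps nsat_subst z s by blast
  qed
  moreover have "(\<exists>z. x + (z + 1) = y) \<longleftrightarrow> x < y" for x y :: nat
    using less_iff_Suc_add by auto
  ultimately show ?thesis using assms unfolding PA_def by auto
qed

lemma P_free_subst: "P_free (subst_fm \<sigma> \<phi>) \<longleftrightarrow> P_free \<phi>"
  by (induction \<phi> arbitrary: \<sigma>) auto

lemma set_subst_trm: "(\<And>i. set_trm (\<sigma> i) = {}) \<Longrightarrow> set_trm (subst_trm \<sigma> t) = set_trm t"
  by (induction t) auto

lemma set_lift_subst: "(\<And>i. set_trm (\<sigma> i) = {}) \<Longrightarrow> set_trm (lift_subst \<sigma> i) = {}"
  by (cases i) (simp_all add: lift_subst_def set_subst_trm)

lemma set_subst_fm: "(\<And>i. set_trm (\<sigma> i) = {}) \<Longrightarrow> set_fm (subst_fm \<sigma> \<phi>) = set_fm \<phi>"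
  by (induction \<phi> arbitrary: \<sigma>) (auto simp: set_subst_trm set_lift_subst)

lemma PA_L_formula:
  assumes "\<phi> \<in> PA"
  shows "L_formula \<phi>"
proof -
  have "L_formula (induction_axiom \<psi>)" if "L_formula \<psi>" for \<psi> :: "'a fm"
  proof -
    have "set_trm (case_nat Zero Var i :: 'a trm) = {}"
      "set_trm (case_nat (Add (Var 0) One) (\<lambda>i. Var (Suc i)) i :: 'a trm) = {}" for i
      by (auto split: nat.split)
    then show ?thesis using that
      unfolding L_formula_def induction_axiom_def by (simp add: P_free_subst set_subst_fm)
  qed
  then show ?thesis using assms unfolding PA_def by (auto simp: L_formula_def)
qed

section \<open>Skolem terms\<close>

instance trm :: (countable) countable by countable_datatype
instance fm :: (countable) countable by countable_datatype

text \<open>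
  Besides Skolem terms there are indicators \<open>Truth\<close>. The residue modulo 2 of an indicator is
  eventually constant, so that no ultrafilter is needed: the reduced product over the cofinite filter,
  restricted to terms, already satisfies Los's theorem. \<open>Base\<close> stands for the components of the code.
\<close>

datatype 'v sk =
    Gen 'v
  | Base nat
  | Least "unit fm" "'v sk list"
  | Truth "unit fm" "'v sk list"

instance sk :: (countable) countable by countable_datatype

definition env :: "nat list \<Rightarrow> nat \<Rightarrow> nat" where
  "env xs i = (if i < length xs then xs ! i else 0)"

primrec ev :: "(nat \<Rightarrow> nat) \<Rightarrow> ('v \<Rightarrow> nat) \<Rightarrow> 'v sk \<Rightarrow> nat" where
  "ev \<kappa> \<rho> (Gen x) = \<rho> x"
| "ev \<kappa> \<rho> (Base n) = \<kappa> n"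
| "ev \<kappa> \<rho> (Least \<phi> ts) = (LEAST y. nsat (case_nat y (env (map (ev \<kappa> \<rho>) ts))) \<phi>)"
| "ev \<kappa> \<rho> (Truth \<phi> ts) = (if nsat (env (map (ev \<kappa> \<rho>) ts)) \<phi> then 1 else 0)"

lemma ev_map: "ev \<kappa> \<rho> (map_sk f \<tau>) = ev \<kappa> (\<lambda>x. \<rho> (f x)) \<tau>"
proof (induction \<tau>)
  case (Least \<phi> ts)
  have "map (ev \<kappa> \<rho>) (map (map_sk f) ts) = map (ev \<kappa> (\<lambda>x. \<rho> (f x))) ts"
    unfolding list.map_comp comp_def by (intro map_cong refl Least)
  then show ?case by (simp only: sk.map ev.simps)
next
  case (Truth \<phi> ts)
  have "map (ev \<kappa> \<rho>) (map (map_sk f) ts) = map (ev \<kappa> (\<lambda>x. \<rho> (f x))) ts"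
    unfolding list.map_comp comp_def by (intro map_cong refl Truth)
  then show ?case by (simp only: sk.map ev.simps)
qed auto

lemma ev_cong: "(\<And>x. x \<in> set_sk \<tau> \<Longrightarrow> \<rho> x = \<rho>' x) \<Longrightarrow> ev \<kappa> \<rho> \<tau> = ev \<kappa> \<rho>' \<tau>"
proof (induction \<tau>)
  case (Least \<phi> ts)
  have "ev \<kappa> \<rho> s = ev \<kappa> \<rho>' s" if "s \<in> set ts" for s
    by (rule Least.IH[OF that]) (use Least.prems that in auto)
  then have "map (ev \<kappa> \<rho>) ts = map (ev \<kappa> \<rho>') ts" by (intro map_cong refl)
  then show ?case by (simp only: ev.simps)
next
  case (Truth \<phi> ts)
  have "ev \<kappa> \<rho> s = ev \<kappa> \<rho>' s" if "s \<in> set ts" for s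
    by (rule Truth.IH[OF that]) (use Truth.prems that in auto)
  then have "map (ev \<kappa> \<rho>) ts = map (ev \<kappa> \<rho>') ts" by (intro map_cong refl)
  then show ?case by (simp only: ev.simps)
qed auto

lemma finite_set_sk: "finite (set_sk \<tau>)"
  by (induction \<tau>) auto

definition base :: "code \<Rightarrow> nat \<Rightarrow> nat" where
  "base c n = (if n = 0 then fst c else if n = 1 then fst (snd c) else bnd c)"

text \<open>Terms over generators named by natural numbers are countable, so numbers can index them;
  \<open>ys\<close> supplies the values of the generators.\<close>

definition skolem :: "nat \<Rightarrow> code \<Rightarrow> nat list \<Rightarrow> nat" where
  "skolem i c ys = ev (base c) (env ys) (from_nat i :: nat sk)"

text \<open>Replacing each branch by a position in \<open>xs\<close> turns a term over uncountably
  many generators into a numbered one. The number depends on neither the code nor the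
  values.\<close>

lemma skolem_ex:
  assumes "set_sk \<tau> \<subseteq> set xs"
  shows "\<exists>i. \<forall>c f. skolem i c (map f xs) = ev (base c) f \<tau>"
proof -
  have "\<forall>x. x \<in> set xs \<longrightarrow> (\<exists>n. n < length xs \<and> xs ! n = x)" by (metis in_set_conv_nth)
  then obtain p where p: "\<And>x. x \<in> set xs \<Longrightarrow> p x < length xs \<and> xs ! p x = x" by metis
  have "skolem (to_nat (map_sk p \<tau>)) c (map f xs) = ev (base c) f \<tau>" for c f
  proof -
    have "ev (base c) (\<lambda>x. env (map f xs) (p x)) \<tau> = ev (base c) f \<tau>"
      by (rule ev_cong) (use assms p in \<open>auto simp: env_def\<close>)
    then show ?thesis by (simp add: skolem_def ev_map)
  qed
  then show ?thesis by blast
qed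

text \<open>Functions are replaced by their graphs so that a class modulo eventual equality fits into \<open>universe\<close>.\<close>

definition cl :: "(nat \<Rightarrow> nat) \<Rightarrow> universe" where
  "cl F = {(\<lambda>G. range (\<lambda>n. prod_encode (n, G n))) ` {G. \<forall>\<^sub>F t in sequentially. G t = F t}}"

lemma cl_eq_iff: "cl F = cl G \<longleftrightarrow> (\<forall>\<^sub>F t in sequentially. F t = G t)"
proof
  assume "cl F = cl G"
  moreover have "range (\<lambda>n. prod_encode (n, F n)) \<in> (\<lambda>G. range (\<lambda>n. prod_encode (n, G n))) ` {H. \<forall>\<^sub>F t in sequentially. H t = F t}"
    by (rule imageI) simp
  ultimately have "range (\<lambda>n. prod_encode (n, F n)) \<in> (\<lambda>G. range (\<lambda>n. prod_encode (n, G n))) ` {H. \<forall>\<^sub>F t in sequentially. H t = G t}"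
    unfolding cl_def by simp
  then obtain H where H: "\<forall>\<^sub>F t in sequentially. H t = G t"
    "range (\<lambda>n. prod_encode (n, F n)) = range (\<lambda>n. prod_encode (n, H n))" by auto
  have "F n = H n" for n
  proof -
    have "prod_encode (n, F n) \<in> range (\<lambda>n. prod_encode (n, H n))" using H(2) by auto
    then show ?thesis by (auto simp: prod_encode_eq)
  qed
  then show "\<forall>\<^sub>F t in sequentially. F t = G t" using H(1) by simp
next
  assume FG: "\<forall>\<^sub>F t in sequentially. F t = G t"
  have "(\<forall>\<^sub>F t in sequentially. H t = F t) \<longleftrightarrow> (\<forall>\<^sub>F t in sequentially. H t = G t)" for H
  proof
    assume "\<forall>\<^sub>F t in sequentially. H t = F t"
    with FG show "\<forall>\<^sub>F t in sequentially. H t = G t" by eventually_elim simp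
  next
    assume "\<forall>\<^sub>F t in sequentially. H t = G t"
    with FG show "\<forall>\<^sub>F t in sequentially. H t = F t" by eventually_elim simp
  qed
  then show "cl F = cl G" unfolding cl_def by simp
qed

type_synonym branch = "nat \<Rightarrow> bool"

section \<open>The reduced product of the stages\<close>

text \<open>The outcome of the fusion, restated for terms over branches. The numbers
  \<open>k\<close>, \<open>s\<close> and \<open>m\<close> are standard here; nonstandard arguments
  enter only through terms.\<close>

locale tower =
  fixes C :: "nat \<Rightarrow> code" and Y :: "nat \<Rightarrow> nat list"
    and V :: "nat \<Rightarrow> branch sk \<Rightarrow> nat"
  assumes V_def: "V = (\<lambda>t. ev (base (C t)) (\<lambda>x. Y t ! leaf t x))"
    and bnd_ge: "t \<le> bnd (C t)"
    and residue: "0 < k \<Longrightarrow> \<exists>v. \<forall>\<^sub>F t in sequentially. V t \<tau> mod k = v"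
    and capture: "\<exists>k0. \<forall>k\<ge>k0. \<exists>s0. \<forall>s\<ge>s0. \<forall>\<^sub>F t in sequentially. V t \<tau> mod k \<in> slalom (C t) k s"
    and avoid: "x \<notin> set_sk \<sigma> \<Longrightarrow> x \<notin> set_sk \<tau> \<Longrightarrow>
      \<exists>m. \<forall>\<^sub>F t in sequentially. \<not> caught (C t) m (V t \<sigma>) (V t \<tau>) (V t (Gen x))"
begin

lemma V_Base [simp]: "V t (Base n) = base (C t) n"
  by (simp add: V_def)

lemma V_Least: "V t (Least \<phi> ts) = (LEAST y. nsat (case_nat y (env (map (V t) ts))) \<phi>)"
  by (simp add: V_def)

lemma V_Truth: "V t (Truth \<phi> ts) = (if nsat (env (map (V t) ts)) \<phi> then 1 else 0)"
  by (simp add: V_def)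

text \<open>The indicator of \<open>\<phi>\<close> at these arguments is a term with values 0 and 1,
  so its residue modulo 2 is its value.\<close>

lemma decisive:
  fixes \<phi> :: "'a fm"
  shows "(\<forall>\<^sub>F t in sequentially. nsat (\<lambda>i. V t (\<sigma> i)) \<phi>) \<or> (\<forall>\<^sub>F t in sequentially. \<not> nsat (\<lambda>i. V t (\<sigma> i)) \<phi>)"
proof -
  obtain n where n: "closed_fm n \<phi>" using closed_fm_ex by blast
  let ?\<tau> = "Truth (map_fm (\<lambda>_. ()) \<phi>) (map \<sigma> [0..<n])"
  have T: "V t ?\<tau> = (if nsat (\<lambda>i. V t (\<sigma> i)) \<phi> then 1 else 0)" for t
  proof -
    have "nsat (env (map (V t) (map \<sigma> [0..<n]))) \<phi> \<longleftrightarrow> nsat (\<lambda>i. V t (\<sigma> i)) \<phi>"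
      by (rule nsat_cong[OF n]) (simp add: env_def)
    then show ?thesis unfolding V_Truth nsat_map by simp
  qed
  obtain v where v: "\<forall>\<^sub>F t in sequentially. V t ?\<tau> mod 2 = v" using residue[of 2 ?\<tau>] by auto
  show ?thesis
  proof (cases "v = 1")
    case True
    have "\<forall>\<^sub>F t in sequentially. nsat (\<lambda>i. V t (\<sigma> i)) \<phi>"
      using v by (rule eventually_mono) (auto simp: T True split: if_splits)
    then show ?thesis ..
  next
    case False
    have "\<forall>\<^sub>F t in sequentially. \<not> nsat (\<lambda>i. V t (\<sigma> i)) \<phi>"
      using v by (rule eventually_mono) (use False in \<open>auto simp: T split: if_splits\<close>)
    then show ?thesis ..
  qed
qed

lemma skolem_closed:
  fixes \<phi> :: "'a fm"
  shows "\<exists>\<tau>. \<forall>t. V t \<tau> = (LEAST y. nsat (case_nat y (\<lambda>i. V t (\<sigma> i))) \<phi>)"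
proof -
  obtain n where "closed_fm n \<phi>" using closed_fm_ex by blast
  then have n: "closed_fm (Suc n) \<phi>" by (rule closed_fm_mono) simp
  have "V t (Least (map_fm (\<lambda>_. ()) \<phi>) (map \<sigma> [0..<n])) = (LEAST y. nsat (case_nat y (\<lambda>i. V t (\<sigma> i))) \<phi>)" for t
  proof -
    have "nsat (case_nat y (env (map (V t) (map \<sigma> [0..<n])))) \<phi> \<longleftrightarrow> nsat (case_nat y (\<lambda>i. V t (\<sigma> i))) \<phi>" for y
      by (rule nsat_cong[OF n]) (auto simp: env_def less_Suc_eq_0_disj)
    then show ?thesis unfolding V_Least nsat_map by simp
  qed
  then show ?thesis by blast
qed

lemma zero_closed: "\<exists>\<tau>. \<forall>t. V t \<tau> = 0"
proof -
  obtain \<tau> where "\<forall>t. V t \<tau> = (LEAST y. nsat (case_nat y (\<lambda>i. V t (Base i))) (Eq (Var 0) Zero :: unit fm))"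
    using skolem_closed[of Base] by blast
  then have "\<forall>t. V t \<tau> = 0" by simp
  then show ?thesis ..
qed

lemma one_closed: "\<exists>\<tau>. \<forall>t. V t \<tau> = 1"
proof -
  obtain \<tau> where \<tau>: "\<forall>t. V t \<tau> = (LEAST y. nsat (case_nat y (\<lambda>i. V t (Base i))) (Eq (Var 0) One :: unit fm))"
    using skolem_closed[of Base] by blast
  have "(LEAST y. y = (1::nat)) = 1" by (rule Least_equality) auto
  then have "\<forall>t. V t \<tau> = 1" using \<tau> by simp
  then show ?thesis ..
qed

lemma binary_closed:
  fixes f :: "nat \<Rightarrow> nat \<Rightarrow> nat" and tr :: "unit trm"
  assumes "\<And>e. neval e tr = f (e 1) (e 2)"
  shows "\<exists>\<tau>. \<forall>t. V t \<tau> = f (V t \<sigma>1) (V t \<sigma>2)"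
proof -
  obtain \<tau> where \<tau>: "\<forall>t. V t \<tau> = (LEAST y. nsat (case_nat y (\<lambda>i. V t (if i = 0 then \<sigma>1 else \<sigma>2))) (Eq (Var 0) tr))"
    using skolem_closed[of "\<lambda>i. if i = 0 then \<sigma>1 else \<sigma>2"] by blast
  have "(LEAST y. y = (z::nat)) = z" for z by (rule Least_equality) auto
  then have "\<forall>t. V t \<tau> = f (V t \<sigma>1) (V t \<sigma>2)" using \<tau> by (simp add: assms numeral_2_eq_2)
  then show ?thesis ..
qed

lemma add_closed: "\<exists>\<tau>. \<forall>t. V t \<tau> = V t \<sigma>1 + V t \<sigma>2"
  by (rule binary_closed[of "Add (Var 1) (Var 2)"]) simp

lemma mul_closed: "\<exists>\<tau>. \<forall>t. V t \<tau> = V t \<sigma>1 * V t \<sigma>2"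
  by (rule binary_closed[of "Mul (Var 1) (Var 2)"]) simp

definition el :: "branch sk \<Rightarrow> universe" where
  "el \<tau> = cl (\<lambda>t. V t \<tau>)"

lemma el_eq_iff: "el \<sigma> = el \<tau> \<longleftrightarrow> (\<forall>\<^sub>F t in sequentially. V t \<sigma> = V t \<tau>)"
  unfolding el_def cl_eq_iff ..

definition rep :: "universe \<Rightarrow> branch sk" where
  "rep x = (SOME \<tau>. el \<tau> = x)"

lemma rep_el: "\<forall>\<^sub>F t in sequentially. V t (rep (el \<tau>)) = V t \<tau>"
proof -
  have "el (rep (el \<tau>)) = el \<tau>" unfolding rep_def by (rule someI_ex) blast
  then show ?thesis unfolding el_eq_iff .
qed

definition model :: "universe arith_struct" where
  "model = \<lparr>carrier = range el, zero = cl (\<lambda>_. 0), one = cl (\<lambda>_. 1),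
     add = \<lambda>x y. cl (\<lambda>t. V t (rep x) + V t (rep y)),
     mul = \<lambda>x y. cl (\<lambda>t. V t (rep x) * V t (rep y)),
     less = \<lambda>x y. \<forall>\<^sub>F t in sequentially. V t (rep x) < V t (rep y)\<rparr>"

lemma carrier_model [simp]: "carrier model = range el"
  by (simp add: model_def)

lemma add_el: "add model (el \<sigma>) (el \<tau>) = cl (\<lambda>t. V t \<sigma> + V t \<tau>)"
  unfolding model_def arith_struct.simps cl_eq_iff
  using rep_el[of \<sigma>] rep_el[of \<tau>] by eventually_elim simp

lemma mul_el: "mul model (el \<sigma>) (el \<tau>) = cl (\<lambda>t. V t \<sigma> * V t \<tau>)"
  unfolding model_def arith_struct.simps cl_eq_iff
  using rep_el[of \<sigma>] rep_el[of \<tau>] by eventually_elim simp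

lemma less_el: "less model (el \<sigma>) (el \<tau>) \<longleftrightarrow> (\<forall>\<^sub>F t in sequentially. V t \<sigma> < V t \<tau>)"
proof -
  have "\<forall>\<^sub>F t in sequentially. (V t (rep (el \<sigma>)) < V t (rep (el \<tau>))) = (V t \<sigma> < V t \<tau>)"
    using rep_el[of \<sigma>] rep_el[of \<tau>] by eventually_elim simp
  then show ?thesis unfolding model_def arith_struct.simps by (rule eventually_subst)
qed

lemma eval_el:
  "set_trm tr = {} \<Longrightarrow>
   \<exists>\<tau>. eval model (\<lambda>i. el (\<sigma> i)) tr = el \<tau> \<and> (\<forall>t. V t \<tau> = neval (\<lambda>i. V t (\<sigma> i)) tr)"
proof (induction tr)
  case (Var i)
  show ?case by (rule exI[of _ "\<sigma> i"]) simp
next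
  case (Par a)
  then show ?case by simp
next
  case Zero
  obtain \<tau> where "\<forall>t. V t \<tau> = 0" using zero_closed by blast
  then show ?case by (intro exI[of _ \<tau>]) (simp add: el_def model_def)
next
  case One
  obtain \<tau> where "\<forall>t. V t \<tau> = 1" using one_closed by blast
  then show ?case by (intro exI[of _ \<tau>]) (simp add: el_def model_def)
next
  case (Add s t)
  then obtain \<tau>1 \<tau>2 where 1: "eval model (\<lambda>i. el (\<sigma> i)) s = el \<tau>1" "\<forall>t. V t \<tau>1 = neval (\<lambda>i. V t (\<sigma> i)) s"
    and 2: "eval model (\<lambda>i. el (\<sigma> i)) t = el \<tau>2" "\<forall>u. V u \<tau>2 = neval (\<lambda>i. V u (\<sigma> i)) t" by auto
  obtain \<tau> where "\<forall>t. V t \<tau> = V t \<tau>1 + V t \<tau>2" using add_closed by blast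
  then show ?case using 1 2 by (intro exI[of _ \<tau>]) (simp add: add_el el_def[of \<tau>])
next
  case (Mul s t)
  then obtain \<tau>1 \<tau>2 where 1: "eval model (\<lambda>i. el (\<sigma> i)) s = el \<tau>1" "\<forall>t. V t \<tau>1 = neval (\<lambda>i. V t (\<sigma> i)) s"
    and 2: "eval model (\<lambda>i. el (\<sigma> i)) t = el \<tau>2" "\<forall>u. V u \<tau>2 = neval (\<lambda>i. V u (\<sigma> i)) t" by auto
  obtain \<tau> where "\<forall>t. V t \<tau> = V t \<tau>1 * V t \<tau>2" using mul_closed by blast
  then show ?case using 1 2 by (intro exI[of _ \<tau>]) (simp add: mul_el el_def[of \<tau>])
qed

lemma case_nat_el: "case_nat (el \<tau>) (\<lambda>i. el (\<sigma> i)) = (\<lambda>i. el (case_nat \<tau> \<sigma> i))"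
  by (rule ext) (simp split: nat.split)

lemma case_nat_V: "(\<lambda>i. V t (case_nat \<tau> \<sigma> i)) = case_nat (V t \<tau>) (\<lambda>i. V t (\<sigma> i))"
  by (rule ext) (simp split: nat.split)

text \<open>\<open>decisive\<close> replaces the ultrafilter at negations. At a universal quantifier
  it suffices to test the least counterexample, which is again a Skolem term.\<close>

lemma Los:
  "P_free \<phi> \<Longrightarrow> set_fm \<phi> = {} \<Longrightarrow>
   sat model B (\<lambda>i. el (\<sigma> i)) \<phi> \<longleftrightarrow> (\<forall>\<^sub>F t in sequentially. nsat (\<lambda>i. V t (\<sigma> i)) \<phi>)"
proof (induction \<phi> arbitrary: \<sigma>)
  case (Eq s t)
  then obtain \<tau>1 \<tau>2 where 1: "eval model (\<lambda>i. el (\<sigma> i)) s = el \<tau>1" "\<forall>u. V u \<tau>1 = neval (\<lambda>i. V u (\<sigma> i)) s"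
    and 2: "eval model (\<lambda>i. el (\<sigma> i)) t = el \<tau>2" "\<forall>u. V u \<tau>2 = neval (\<lambda>i. V u (\<sigma> i)) t"
    using eval_el[of s \<sigma>] eval_el[of t \<sigma>] by auto
  then show ?case by (simp add: el_eq_iff)
next
  case (Less s t)
  then obtain \<tau>1 \<tau>2 where 1: "eval model (\<lambda>i. el (\<sigma> i)) s = el \<tau>1" "\<forall>u. V u \<tau>1 = neval (\<lambda>i. V u (\<sigma> i)) s"
    and 2: "eval model (\<lambda>i. el (\<sigma> i)) t = el \<tau>2" "\<forall>u. V u \<tau>2 = neval (\<lambda>i. V u (\<sigma> i)) t"
    using eval_el[of s \<sigma>] eval_el[of t \<sigma>] by auto
  then show ?case by (simp add: less_el)
next
  case (InP t)
  then show ?case by simp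
next
  case (Neg \<phi>)
  have ih: "sat model B (\<lambda>i. el (\<sigma> i)) \<phi> \<longleftrightarrow> (\<forall>\<^sub>F t in sequentially. nsat (\<lambda>i. V t (\<sigma> i)) \<phi>)"
    using Neg by simp
  have "\<not> (\<forall>\<^sub>F t in sequentially. nsat (\<lambda>i. V t (\<sigma> i)) \<phi>) \<longleftrightarrow> (\<forall>\<^sub>F t in sequentially. \<not> nsat (\<lambda>i. V t (\<sigma> i)) \<phi>)"
  proof
    assume "\<forall>\<^sub>F t in sequentially. \<not> nsat (\<lambda>i. V t (\<sigma> i)) \<phi>"
    then show "\<not> (\<forall>\<^sub>F t in sequentially. nsat (\<lambda>i. V t (\<sigma> i)) \<phi>)"
      using eventually_conj[of "\<lambda>t. \<not> nsat (\<lambda>i. V t (\<sigma> i)) \<phi>" sequentially "\<lambda>t. nsat (\<lambda>i. V t (\<sigma> i)) \<phi>"]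
      by (auto simp: eventually_False)
  qed (use decisive in blast)
  then show ?case using ih by simp
next
  case (Conj \<phi> \<psi>)
  then show ?case by (simp add: eventually_conj_iff)
next
  case (Forall \<phi>)
  have ih: "sat model B (case_nat (el \<tau>) (\<lambda>i. el (\<sigma> i))) \<phi> \<longleftrightarrow>
      (\<forall>\<^sub>F t in sequentially. nsat (case_nat (V t \<tau>) (\<lambda>i. V t (\<sigma> i))) \<phi>)" for \<tau>
    unfolding case_nat_el case_nat_V[symmetric] using Forall.prems by (intro Forall.IH) auto
  have "(\<forall>\<tau>. \<forall>\<^sub>F t in sequentially. nsat (case_nat (V t \<tau>) (\<lambda>i. V t (\<sigma> i))) \<phi>) \<longleftrightarrow>
      (\<forall>\<^sub>F t in sequentially. \<forall>a. nsat (case_nat a (\<lambda>i. V t (\<sigma> i))) \<phi>)"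
  proof (intro iffI allI)
    assume all: "\<forall>\<tau>. \<forall>\<^sub>F t in sequentially. nsat (case_nat (V t \<tau>) (\<lambda>i. V t (\<sigma> i))) \<phi>"
    obtain \<tau> where \<tau>: "\<forall>t. V t \<tau> = (LEAST y. nsat (case_nat y (\<lambda>i. V t (\<sigma> i))) (Neg \<phi>))"
      using skolem_closed by blast
    from all have "\<forall>\<^sub>F t in sequentially. nsat (case_nat (V t \<tau>) (\<lambda>i. V t (\<sigma> i))) \<phi>" ..
    then show "\<forall>\<^sub>F t in sequentially. \<forall>a. nsat (case_nat a (\<lambda>i. V t (\<sigma> i))) \<phi>"
    proof (rule eventually_mono)
      fix t assume h: "nsat (case_nat (V t \<tau>) (\<lambda>i. V t (\<sigma> i))) \<phi>"
      show "\<forall>a. nsat (case_nat a (\<lambda>i. V t (\<sigma> i))) \<phi>"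
      proof (rule ccontr)
        assume "\<not> (\<forall>a. nsat (case_nat a (\<lambda>i. V t (\<sigma> i))) \<phi>)"
        then obtain a where "nsat (case_nat a (\<lambda>i. V t (\<sigma> i))) (Neg \<phi>)" by auto
        then have "nsat (case_nat (LEAST y. nsat (case_nat y (\<lambda>i. V t (\<sigma> i))) (Neg \<phi>)) (\<lambda>i. V t (\<sigma> i))) (Neg \<phi>)"
          by (rule LeastI)
        then show False using h \<tau> by simp
      qed
    qed
  next
    fix \<tau> assume "\<forall>\<^sub>F t in sequentially. \<forall>a. nsat (case_nat a (\<lambda>i. V t (\<sigma> i))) \<phi>"
    then show "\<forall>\<^sub>F t in sequentially. nsat (case_nat (V t \<tau>) (\<lambda>i. V t (\<sigma> i))) \<phi>"
      by (rule eventually_mono) blast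
  qed
  then show ?case by (simp add: ih)
qed

lemma is_structure_model: "is_structure model"
proof -
  obtain \<tau>0 \<tau>1 where "\<forall>t. V t \<tau>0 = 0" "\<forall>t. V t \<tau>1 = 1" using zero_closed one_closed by blast
  then have "zero model = el \<tau>0" "one model = el \<tau>1" by (simp_all add: model_def el_def)
  moreover have "add model (el \<sigma>) (el \<tau>) \<in> range el" "mul model (el \<sigma>) (el \<tau>) \<in> range el" for \<sigma> \<tau>
  proof -
    obtain \<tau>a \<tau>m where "\<forall>t. V t \<tau>a = V t \<sigma> + V t \<tau>" "\<forall>t. V t \<tau>m = V t \<sigma> * V t \<tau>"
      using add_closed mul_closed by metis
    then have "add model (el \<sigma>) (el \<tau>) = el \<tau>a" "mul model (el \<sigma>) (el \<tau>) = el \<tau>m"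
      by (simp_all add: add_el mul_el el_def[of \<tau>a] el_def[of \<tau>m])
    then show "add model (el \<sigma>) (el \<tau>) \<in> range el" "mul model (el \<sigma>) (el \<tau>) \<in> range el" by simp_all
  qed
  ultimately show ?thesis unfolding is_structure_def by auto
qed

lemma PA_model_model: "PA_model model"
  unfolding PA_model_def holds_def
proof (intro conjI ballI allI impI is_structure_model)
  fix \<phi> :: "universe fm" and e :: "nat \<Rightarrow> universe" assume \<phi>: "\<phi> \<in> PA" and "\<forall>i. e i \<in> carrier model"
  then have "\<forall>i. \<exists>\<tau>. e i = el \<tau>" by auto
  then obtain \<sigma> where "e = (\<lambda>i. el (\<sigma> i))" by metis
  then show "sat model {} e \<phi>"
    using PA_L_formula[OF \<phi>] PA_true[OF \<phi>] by (simp add: L_formula_def Los)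
qed

section \<open>Standard and nonstandard elements\<close>

lemma less_dichotomy:
  "(\<forall>\<^sub>F t in sequentially. V t \<sigma> < V t \<tau>) \<or> (\<forall>\<^sub>F t in sequentially. V t \<tau> \<le> V t \<sigma>)"
  using decisive[of "case_nat \<sigma> (\<lambda>_. \<tau>)" "Less (Var 0) (Var 1) :: unit fm"] by (simp add: not_less)

lemma numeral_ex: "\<exists>\<tau>. \<forall>t. V t \<tau> = n"
proof (induction n)
  case 0
  show ?case by (rule zero_closed)
next
  case (Suc n)
  then obtain \<tau> where \<tau>: "\<forall>t. V t \<tau> = n" ..
  obtain \<tau>1 where \<tau>1: "\<forall>t. V t \<tau>1 = 1" using one_closed ..
  obtain \<tau>' where "\<forall>t. V t \<tau>' = V t \<tau> + V t \<tau>1" using add_closed by blast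
  then show ?case using \<tau> \<tau>1 by (intro exI[of _ \<tau>']) simp
qed

definition num :: "nat \<Rightarrow> branch sk" where
  "num n = (SOME \<tau>. \<forall>t. V t \<tau> = n)"

lemma V_num [simp]: "V t (num n) = n"
  using someI_ex[OF numeral_ex[of n]] unfolding num_def by blast

definition plus1 :: "branch sk \<Rightarrow> branch sk" where
  "plus1 \<sigma> = (SOME \<tau>. \<forall>t. V t \<tau> = V t \<sigma> + 1)"

lemma V_plus1 [simp]: "V t (plus1 \<sigma>) = Suc (V t \<sigma>)"
proof -
  obtain \<tau> where "\<forall>t. V t \<tau> = V t \<sigma> + V t (num 1)" using add_closed by blast
  then have "\<exists>\<tau>. \<forall>t. V t \<tau> = V t \<sigma> + 1" by (intro exI[of _ \<tau>]) simp
  then have "\<forall>t. V t (plus1 \<sigma>) = V t \<sigma> + 1" unfolding plus1_def by (rule someI_ex)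
  then show ?thesis by simp
qed

lemma one_el: "one model = el (num 1)"
  by (simp add: model_def el_def)

lemma zero_el: "zero model = el (num 0)"
  by (simp add: model_def el_def)

lemma plus_one_el: "add model (el \<sigma>) (one model) = el (plus1 \<sigma>)"
  by (simp add: one_el add_el el_def[of "plus1 \<sigma>"])

lemma standard_part_model: "standard_part model = range (\<lambda>n. el (num n))"
proof -
  have "((\<lambda>x. add model x (one model)) ^^ n) (zero model) = el (num n)" for n
  proof (induction n)
    case 0
    show ?case by (simp add: zero_el)
  next
    case (Suc n)
    then show ?case by (simp add: plus_one_el el_eq_iff)
  qed
  then show ?thesis unfolding standard_part_def by simp
qed

text \<open>A value below \<open>n\<close> equals its residue modulo \<open>n\<close>, which is
  eventually constant.\<close>

lemma standard_if_bounded: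
  assumes "\<forall>\<^sub>F t in sequentially. V t \<tau> < n"
  shows "el \<tau> \<in> standard_part model"
proof -
  have "0 < n"
  proof (rule ccontr)
    assume "\<not> 0 < n"
    then have "\<forall>\<^sub>F t in sequentially. False" using assms by simp
    then show False by simp
  qed
  then obtain v where "\<forall>\<^sub>F t in sequentially. V t \<tau> mod n = v" using residue by blast
  then have "\<forall>\<^sub>F t in sequentially. V t \<tau> = V t (num v)" using assms by eventually_elim simp
  then have "el \<tau> = el (num v)" unfolding el_eq_iff .
  then show ?thesis unfolding standard_part_model by simp
qed

lemma bound_nonstandard: "el (Base 2) \<notin> standard_part model"
proof
  assume "el (Base 2) \<in> standard_part model"
  then obtain n where "el (Base 2) = el (num n)" unfolding standard_part_model by blast
  then have "\<forall>\<^sub>F t in sequentially. bnd (C t) = n" unfolding el_eq_iff by (simp add: base_def)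
  moreover have "\<forall>\<^sub>F t in sequentially. n < t" by (rule eventually_gt_at_top)
  ultimately have "\<forall>\<^sub>F t in sequentially. False"
    by eventually_elim (use bnd_ge in \<open>metis leD\<close>)
  then show False by simp
qed

end

section \<open>The sentence\<close>

text \<open>In \<open>slalom_fm\<close> the indices 0, 2, 4, 5, 6 stand for \<open>s\<close>, \<open>k\<close>, \<open>z\<close> and the second and the
  first component of the code; 1 and 3 are bound by the quantifiers over the thresholds.\<close>

definition slalom_fm :: "'a fm" where
  "slalom_fm =
    (let f = Var 0; r = Var 1; q = Var 2; s = Var 3; k = Var 5; z = Var 7; m = Var 8; a = Var 9;
         u = Add (Add (Mul (Add k s) (Add k s)) k) r
     in Exists (Exists (Exists (Conj (Less r k) (Conj (Eq z (Add (Mul k q) r))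
          (Eq a (Mul (Add One (Mul m (Add (Add (Mul u u) r) One))) f)))))))"

lemma nsat_slalom_fm:
  assumes "c = (e 6, e 5, b)"
  shows "nsat e slalom_fm \<longleftrightarrow> e 4 mod e 2 \<in> slalom c (e 2) (e 0)"
proof -
  have "nsat e slalom_fm \<longleftrightarrow> (\<exists>q r f. r < e 2 \<and> e 4 = e 2 * q + r \<and> e 6 = (1 + e 5 * (tri (e 2) (e 0) r + 1)) * f)"
    by (simp add: slalom_fm_def Let_def tri_def eval_nat_numeral) blast
  also have "\<dots> \<longleftrightarrow> e 4 mod e 2 \<in> slalom c (e 2) (e 0)"
    unfolding slalom_def assms fst_conv snd_conv mem_Collect_eq dvd_def
  proof
    assume "\<exists>q r f. r < e 2 \<and> e 4 = e 2 * q + r \<and> e 6 = (1 + e 5 * (tri (e 2) (e 0) r + 1)) * f"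
    then obtain q r f where h: "r < e 2" "e 4 = e 2 * q + r" "e 6 = (1 + e 5 * (tri (e 2) (e 0) r + 1)) * f" by blast
    then have "e 4 mod e 2 = r" by simp
    then show "e 4 mod e 2 < e 2 \<and> (\<exists>k. e 6 = (1 + e 5 * (tri (e 2) (e 0) (e 4 mod e 2) + 1)) * k)" using h by blast
  next
    assume "e 4 mod e 2 < e 2 \<and> (\<exists>k. e 6 = (1 + e 5 * (tri (e 2) (e 0) (e 4 mod e 2) + 1)) * k)"
    moreover have "e 4 = e 2 * (e 4 div e 2) + e 4 mod e 2" by simp
    ultimately show "\<exists>q r f. r < e 2 \<and> e 4 = e 2 * q + r \<and> e 6 = (1 + e 5 * (tri (e 2) (e 0) r + 1)) * f" by metis
  qed
  finally show ?thesis .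
qed

lemma slalom_fm_pure: "P_free slalom_fm" "set_fm slalom_fm = {}" "closed_fm 7 slalom_fm"
  by (simp_all add: slalom_fm_def Let_def)

text \<open>The quantifiers bind \<open>z\<close>, \<open>k0\<close>, \<open>k\<close>,
  \<open>s0\<close>, \<open>s\<close> in this order, which gives \<open>slalom_fm\<close> the
  indices it expects; \<open>k0\<close> and \<open>s0\<close> are the thresholds.\<close>

definition capture_fm :: "'a fm" where
  "capture_fm =
    Forall (Exists (Conj (InP (Var 0)) (Forall (Imp (Conj (InP (Var 0)) (Less (Var 1) (Var 0)))
      (Exists (Conj (InP (Var 0)) (Forall (Imp (Conj (InP (Var 0)) (Less (Var 1) (Var 0))) slalom_fm))))))))"

text \<open>The parameters \<open>a\<close> and \<open>m\<close> are passed on through quantified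
  variables, so that \<open>slalom_fm\<close> stays free of parameters and \<open>Los\<close>
  applies to it.\<close>

definition cut_fm :: "'a \<Rightarrow> 'a \<Rightarrow> 'a \<Rightarrow> 'a fm" where
  "cut_fm a m b =
    Conj (InP Zero)
    (Conj (Forall (Imp (InP (Var 0)) (InP (Add (Var 0) One))))
    (Conj (Forall (Forall (Imp (Conj (InP (Var 0)) (Less (Var 1) (Var 0))) (InP (Var 1)))))
    (Conj (Forall (Imp (InP (Var 0)) (Less (Var 0) (Par b))))
      (Exists (Conj (Eq (Var 0) (Par a)) (Exists (Conj (Eq (Var 0) (Par m)) capture_fm)))))))"

lemma sentence_cut_fm: "sentence (cut_fm a m b)"
proof -
  have "closed_fm 8 slalom_fm" by (rule closed_fm_mono[OF slalom_fm_pure(3)]) simp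
  then show ?thesis using slalom_fm_pure(3)
    by (simp add: sentence_def cut_fm_def capture_fm_def eval_nat_numeral)
qed

lemma set_cut_fm: "set_fm (cut_fm a m b) = {a, m, b}"
  by (auto simp: cut_fm_def capture_fm_def slalom_fm_pure)

section \<open>The cuts that satisfy the sentence\<close>

context tower
begin

lemma sat_slalom_fm:
  "sat model B (case_nat (el s) (case_nat (el s0) (case_nat (el k) (case_nat (el k0) (case_nat (el z)
      (case_nat (el (Base 1)) (case_nat (el (Base 0)) (\<lambda>i. el (\<sigma> i))))))))) slalom_fm \<longleftrightarrow>
   (\<forall>\<^sub>F t in sequentially. V t z mod V t k \<in> slalom (C t) (V t k) (V t s))"
  unfolding case_nat_el Los[OF slalom_fm_pure(1,2)]
proof (rule eventually_subst, rule always_eventually, rule allI)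
  fix t
  let ?e = "\<lambda>i. V t (case_nat s (case_nat s0 (case_nat k (case_nat k0 (case_nat z (case_nat (Base 1) (case_nat (Base 0) \<sigma>)))))) i)"
  have "C t = (?e 6, ?e 5, bnd (C t))" by (simp add: base_def bnd_def eval_nat_numeral)
  from nsat_slalom_fm[OF this]
  show "nsat ?e slalom_fm = (V t z mod V t k \<in> slalom (C t) (V t k) (V t s))"
    by (simp add: eval_nat_numeral)
qed

definition cut_cond :: "universe set \<Rightarrow> bool" where
  "cut_cond B \<longleftrightarrow> el (num 0) \<in> B \<and> (\<forall>\<tau>. el \<tau> \<in> B \<longrightarrow> el (plus1 \<tau>) \<in> B) \<and>
     (\<forall>\<sigma> \<tau>. el \<tau> \<in> B \<longrightarrow> (\<forall>\<^sub>F t in sequentially. V t \<sigma> < V t \<tau>) \<longrightarrow> el \<sigma> \<in> B) \<and>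
     (\<forall>\<tau>. el \<tau> \<in> B \<longrightarrow> (\<forall>\<^sub>F t in sequentially. V t \<tau> < bnd (C t))) \<and>
     (\<forall>z. \<exists>k0. el k0 \<in> B \<and> (\<forall>k. el k \<in> B \<longrightarrow> (\<forall>\<^sub>F t in sequentially. V t k0 < V t k) \<longrightarrow>
       (\<exists>s0. el s0 \<in> B \<and> (\<forall>s. el s \<in> B \<longrightarrow> (\<forall>\<^sub>F t in sequentially. V t s0 < V t s) \<longrightarrow>
         (\<forall>\<^sub>F t in sequentially. V t z mod V t k \<in> slalom (C t) (V t k) (V t s))))))"

lemma cut_cond_capture:
  assumes "cut_cond B"
  shows "\<exists>k0. el k0 \<in> B \<and> (\<forall>k. el k \<in> B \<longrightarrow> (\<forall>\<^sub>F t in sequentially. V t k0 < V t k) \<longrightarrow>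
       (\<exists>s0. el s0 \<in> B \<and> (\<forall>s. el s \<in> B \<longrightarrow> (\<forall>\<^sub>F t in sequentially. V t s0 < V t s) \<longrightarrow>
         (\<forall>\<^sub>F t in sequentially. V t z mod V t k \<in> slalom (C t) (V t k) (V t s)))))"
  using assms unfolding cut_cond_def by (elim conjE) (erule spec)

definition the_cut_fm :: "universe fm" where
  "the_cut_fm = cut_fm (el (Base 0)) (el (Base 1)) (el (Base 2))"

lemma sat_cut_fm: "sat model B (\<lambda>i. el (\<sigma> i)) the_cut_fm \<longleftrightarrow> cut_cond B"
proof -
  have "V t (Base 2) = bnd (C t)" for t by (simp add: base_def)
  then show ?thesis
    unfolding the_cut_fm_def cut_fm_def capture_fm_def cut_cond_def
    by (auto simp: sat_slalom_fm[unfolded One_nat_def] less_el plus_one_el zero_el)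
qed

lemma holds_cut_fm: "holds model B the_cut_fm \<longleftrightarrow> cut_cond B"
proof
  assume "holds model B the_cut_fm"
  then have "sat model B (\<lambda>i. el (num 0)) the_cut_fm" unfolding holds_def by simp
  then show "cut_cond B" unfolding sat_cut_fm .
next
  assume c: "cut_cond B"
  show "holds model B the_cut_fm"
    unfolding holds_def
  proof (intro allI impI)
    fix e :: "nat \<Rightarrow> universe" assume "\<forall>i. e i \<in> carrier model"
    then have "\<forall>i. \<exists>\<tau>. e i = el \<tau>" by auto
    then obtain \<sigma> where "e = (\<lambda>i. el (\<sigma> i))" by metis
    then show "sat model B e the_cut_fm" using c sat_cut_fm by simp
  qed
qed

text \<open>Standard elements are eventually constant, so the standard thresholds from
  \<open>capture\<close> can be used as numerals.\<close>

lemma cut_cond_standard: "cut_cond (standard_part model)"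
proof -
  let ?N = "standard_part model"
  have st: "el \<tau> \<in> ?N \<longleftrightarrow> (\<exists>n. \<forall>\<^sub>F t in sequentially. V t \<tau> = n)" for \<tau>
    unfolding standard_part_model image_iff el_eq_iff by simp
  have num: "el (num n) \<in> ?N" for n unfolding standard_part_model by simp
  have 2: "el (plus1 \<tau>) \<in> ?N" if \<tau>: "el \<tau> \<in> ?N" for \<tau>
  proof -
    obtain n where "\<forall>\<^sub>F t in sequentially. V t \<tau> = n" using \<tau> st by blast
    then have "\<forall>\<^sub>F t in sequentially. V t (plus1 \<tau>) = Suc n" by eventually_elim simp
    then show ?thesis using st by blast
  qed
  have 3: "el \<sigma> \<in> ?N" if \<tau>: "el \<tau> \<in> ?N" and lt: "\<forall>\<^sub>F t in sequentially. V t \<sigma> < V t \<tau>" for \<sigma> \<tau>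
  proof -
    obtain n where "\<forall>\<^sub>F t in sequentially. V t \<tau> = n" using \<tau> st by blast
    then have "\<forall>\<^sub>F t in sequentially. V t \<sigma> < n" using lt by eventually_elim simp
    then show ?thesis by (rule standard_if_bounded)
  qed
  have 4: "\<forall>\<^sub>F t in sequentially. V t \<tau> < bnd (C t)" if \<tau>: "el \<tau> \<in> ?N" for \<tau>
  proof -
    obtain n where "\<forall>\<^sub>F t in sequentially. V t \<tau> = n" using \<tau> st by blast
    with eventually_gt_at_top[of n] show ?thesis
      by eventually_elim (use bnd_ge less_le_trans in blast)
  qed
  have 5: "\<exists>k0. el k0 \<in> ?N \<and> (\<forall>k. el k \<in> ?N \<longrightarrow> (\<forall>\<^sub>F t in sequentially. V t k0 < V t k) \<longrightarrow>
       (\<exists>s0. el s0 \<in> ?N \<and> (\<forall>s. el s \<in> ?N \<longrightarrow> (\<forall>\<^sub>F t in sequentially. V t s0 < V t s) \<longrightarrow>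
         (\<forall>\<^sub>F t in sequentially. V t z mod V t k \<in> slalom (C t) (V t k) (V t s)))))" for z
  proof -
    obtain k0 where k0: "\<And>k. k0 \<le> k \<Longrightarrow> \<exists>s0. \<forall>s\<ge>s0. \<forall>\<^sub>F t in sequentially. V t z mod k \<in> slalom (C t) k s"
      using capture[of z] by blast
    show ?thesis
    proof (rule exI[of _ "num k0"], intro conjI num allI impI)
      fix k assume "el k \<in> ?N" and gt: "\<forall>\<^sub>F t in sequentially. V t (num k0) < V t k"
      then obtain k' where k': "\<forall>\<^sub>F t in sequentially. V t k = k'" using st by blast
      have "\<forall>\<^sub>F t in sequentially. k0 < k'" using gt k' by eventually_elim simp
      then have "k0 \<le> k'" by simp
      then obtain s0 where s0: "\<And>s. s0 \<le> s \<Longrightarrow> \<forall>\<^sub>F t in sequentially. V t z mod k' \<in> slalom (C t) k' s"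
        using k0 by blast
      show "\<exists>s0. el s0 \<in> ?N \<and> (\<forall>s. el s \<in> ?N \<longrightarrow> (\<forall>\<^sub>F t in sequentially. V t s0 < V t s) \<longrightarrow>
         (\<forall>\<^sub>F t in sequentially. V t z mod V t k \<in> slalom (C t) (V t k) (V t s)))"
      proof (rule exI[of _ "num s0"], intro conjI num allI impI)
        fix s assume "el s \<in> ?N" and gt: "\<forall>\<^sub>F t in sequentially. V t (num s0) < V t s"
        then obtain s' where s': "\<forall>\<^sub>F t in sequentially. V t s = s'" using st by blast
        have "\<forall>\<^sub>F t in sequentially. s0 < s'" using gt s' by eventually_elim simp
        then have "s0 \<le> s'" by simp
        from s0[OF this] show "\<forall>\<^sub>F t in sequentially. V t z mod V t k \<in> slalom (C t) (V t k) (V t s)"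
          using k' s' by eventually_elim simp
      qed
    qed
  qed
  show ?thesis unfolding cut_cond_def using num[of 0] 2 3 4 5 by blast
qed

text \<open>If no \<open>x\<close> worked, pick for each \<open>x\<close> an element \<open>b x\<close> of \<open>B\<close> above all elements of \<open>B\<close> whose
  terms avoid \<open>x\<close>. For infinitely many \<open>y\<close> and an \<open>x\<close> outside the countable union of the supports of
  the \<open>b y\<close>, some \<open>y\<close> is outside the support of \<open>b x\<close>, and then each of \<open>b x\<close>, \<open>b y\<close> exceeds the other.\<close>

lemma cofinal_without:
  "\<exists>x. \<forall>b. el b \<in> B \<longrightarrow> (\<exists>e. el e \<in> B \<and> x \<notin> set_sk e \<and> (\<forall>\<^sub>F t in sequentially. V t b \<le> V t e))"
proof (rule ccontr)
  assume neg: "\<not> ?thesis"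
  have "\<exists>b. el b \<in> B \<and> (\<forall>e. el e \<in> B \<longrightarrow> x \<notin> set_sk e \<longrightarrow> (\<forall>\<^sub>F t in sequentially. V t e < V t b))" for x
    using neg less_dichotomy by metis
  then obtain b where b: "\<And>x. el (b x) \<in> B"
    and above: "\<And>x e. el e \<in> B \<Longrightarrow> x \<notin> set_sk e \<Longrightarrow> \<forall>\<^sub>F t in sequentially. V t e < V t (b x)"
    by metis
  define y where "y = (\<lambda>n i. i = (n::nat))"
  have inj: "inj y"
  proof (rule injI)
    fix m n assume "y m = y n"
    then have "y m m = y n m" by simp
    then show "m = n" by (simp add: y_def)
  qed
  define S where "S = (\<Union>n. set_sk (b (y n)))"
  have "countable S" unfolding S_def by (rule countable_UN) (simp_all add: countable_finite finite_set_sk)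
  define x where "x = (\<lambda>n. \<not> from_nat_into S n n)"
  have "x \<notin> S"
  proof
    assume "x \<in> S"
    then obtain n where "from_nat_into S n = x" using from_nat_into_surj[OF \<open>countable S\<close>] by blast
    then have "from_nat_into S n n = x n" by simp
    then show False by (simp add: x_def)
  qed
  have "\<not> range y \<subseteq> set_sk (b x)"
    using finite_set_sk finite_subset range_inj_infinite[OF inj] by blast
  then obtain n where n: "y n \<notin> set_sk (b x)" by blast
  have "x \<notin> set_sk (b (y n))" using \<open>x \<notin> S\<close> unfolding S_def by blast
  from above[OF b this] above[OF b n] have "\<forall>\<^sub>F t in sequentially. False" by eventually_elim simp
  then show False by simp
qed

lemma cut_cond_unique:
  assumes B: "B \<subseteq> carrier model" and c: "cut_cond B"
  shows "B = standard_part model"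
proof (rule ccontr)
  assume ne: "B \<noteq> standard_part model"
  have z: "el (num 0) \<in> B" and suc: "\<And>\<tau>. el \<tau> \<in> B \<Longrightarrow> el (plus1 \<tau>) \<in> B"
    and bd: "\<And>\<tau>. el \<tau> \<in> B \<Longrightarrow> \<forall>\<^sub>F t in sequentially. V t \<tau> < bnd (C t)"
    using c unfolding cut_cond_def by blast+
  have "el (num n) \<in> B" for n
  proof (induction n)
    case (Suc n)
    have "el (plus1 (num n)) = el (num (Suc n))" unfolding el_eq_iff by simp
    then show ?case using suc[OF Suc] by simp
  qed (fact z)
  then have "standard_part model \<subseteq> B" unfolding standard_part_model by blast
  then obtain \<nu> where \<nu>: "el \<nu> \<in> B" "el \<nu> \<notin> standard_part model" using ne B by auto
  have big: "\<forall>\<^sub>F t in sequentially. m \<le> V t \<nu>" for m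
    using less_dichotomy[of \<nu> "num m"] standard_if_bounded[of \<nu> m] \<nu>(2) by auto
  obtain x where x: "\<And>b. el b \<in> B \<Longrightarrow> \<exists>e. el e \<in> B \<and> x \<notin> set_sk e \<and> (\<forall>\<^sub>F t in sequentially. V t b \<le> V t e)"
    using cofinal_without[of B] by blast
  obtain k0 where k0: "el k0 \<in> B" and K: "\<forall>k. el k \<in> B \<longrightarrow> (\<forall>\<^sub>F t in sequentially. V t k0 < V t k) \<longrightarrow>
       (\<exists>s0. el s0 \<in> B \<and> (\<forall>s. el s \<in> B \<longrightarrow> (\<forall>\<^sub>F t in sequentially. V t s0 < V t s) \<longrightarrow>
         (\<forall>\<^sub>F t in sequentially. V t (Gen x) mod V t k \<in> slalom (C t) (V t k) (V t s))))"
    using cut_cond_capture[OF c, of "Gen x"] by (elim exE conjE) (rule that)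
  \<comment> \<open>\<open>w\<close> is the larger of \<open>k0\<close> and \<open>\<nu>\<close>. An
    element \<open>k\<close> above it lies where capture is guaranteed and, being above
    \<open>\<nu>\<close>, exceeds every standard threshold \<open>m\<close> of
    \<open>avoid\<close>.\<close>
  have "\<exists>w. el w \<in> B \<and> (\<forall>\<^sub>F t in sequentially. V t k0 \<le> V t w) \<and> (\<forall>\<^sub>F t in sequentially. V t \<nu> \<le> V t w)"
    using less_dichotomy[of k0 \<nu>]
  proof
    assume "\<forall>\<^sub>F t in sequentially. V t k0 < V t \<nu>"
    then have "\<forall>\<^sub>F t in sequentially. V t k0 \<le> V t \<nu>" by eventually_elim simp
    then show ?thesis using \<nu>(1) by (intro exI[of _ \<nu>]) simp
  next
    assume "\<forall>\<^sub>F t in sequentially. V t \<nu> \<le> V t k0"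
    then show ?thesis using k0 by (intro exI[of _ k0]) simp
  qed
  then obtain w where w: "el w \<in> B" "\<forall>\<^sub>F t in sequentially. V t k0 \<le> V t w" "\<forall>\<^sub>F t in sequentially. V t \<nu> \<le> V t w"
    by blast
  obtain k where k: "el k \<in> B" "x \<notin> set_sk k" "\<forall>\<^sub>F t in sequentially. V t (plus1 w) \<le> V t k"
    using x[OF suc[OF w(1)]] by blast
  have "\<forall>\<^sub>F t in sequentially. V t k0 < V t k" using w(2) k(3) by eventually_elim simp
  from K[rule_format, OF k(1) this] obtain s0 where s0: "el s0 \<in> B"
    and S: "\<forall>s. el s \<in> B \<longrightarrow> (\<forall>\<^sub>F t in sequentially. V t s0 < V t s) \<longrightarrow>
         (\<forall>\<^sub>F t in sequentially. V t (Gen x) mod V t k \<in> slalom (C t) (V t k) (V t s))"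
    by (elim exE conjE) (rule that)
  \<comment> \<open>\<open>s0\<close> may depend on \<open>x\<close>, hence the second appeal to
    cofinality; \<open>plus1\<close> makes the inequality strict.\<close>
  obtain s where s: "el s \<in> B" "x \<notin> set_sk s" "\<forall>\<^sub>F t in sequentially. V t (plus1 s0) \<le> V t s"
    using x[OF suc[OF s0]] by blast
  have "\<forall>\<^sub>F t in sequentially. V t s0 < V t s" using s(3) by eventually_elim simp
  from S[rule_format, OF s(1) this] have hit: "\<forall>\<^sub>F t in sequentially. V t (Gen x) mod V t k \<in> slalom (C t) (V t k) (V t s)" .
  obtain m where "\<forall>\<^sub>F t in sequentially. \<not> caught (C t) m (V t k) (V t s) (V t (Gen x))"
    using avoid[OF k(2) s(2)] by blast
  with hit bd[OF k(1)] bd[OF s(1)] big[of m] w(3) k(3) have "\<forall>\<^sub>F t in sequentially. False"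
    by eventually_elim (simp add: caught_def)
  then show False by simp
qed

lemma tower_model:
  "PA_model model \<and> standard_part model \<noteq> carrier model \<and> implicitly_definable model (standard_part model)"
proof (intro conjI)
  show "PA_model model" by (rule PA_model_model)
  show "standard_part model \<noteq> carrier model" using bound_nonstandard by auto
  have "standard_part model \<subseteq> carrier model" unfolding standard_part_model by auto
  then have "{B. B \<subseteq> carrier model \<and> holds model B the_cut_fm} = {standard_part model}"
    unfolding holds_cut_fm using cut_cond_standard cut_cond_unique by blast
  moreover have "sentence the_cut_fm" "set_fm the_cut_fm \<subseteq> carrier model"
    unfolding the_cut_fm_def using sentence_cut_fm by (auto simp: set_cut_fm)
  ultimately show "implicitly_definable model (standard_part model)"
    unfolding implicitly_definable_def by blast
qed

end

theorem mainTheorem3: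
  "\<exists>M :: universe arith_struct.
     PA_model M \<and> standard_part M \<noteq> carrier M \<and>
     implicitly_definable M (standard_part M)"
proof -
  obtain C Y where bnd: "\<forall>t. t \<le> bnd (C t)"
    and res: "\<forall>i xs k. 0 < k \<longrightarrow> (\<exists>v. \<forall>\<^sub>F t in sequentially.
        skolem i (C t) (map (\<lambda>x. Y t ! leaf t x) xs) mod k = v)"
    and cap: "\<forall>i xs. \<exists>k0. \<forall>k\<ge>k0. \<exists>s0. \<forall>s\<ge>s0. \<forall>\<^sub>F t in sequentially.
        skolem i (C t) (map (\<lambda>x. Y t ! leaf t x) xs) mod k \<in> slalom (C t) k s"
    and av: "\<forall>i j xs x. x \<notin> set xs \<longrightarrow> (\<exists>m. \<forall>\<^sub>F t in sequentially.
        \<not> caught (C t) m (skolem i (C t) (map (\<lambda>x. Y t ! leaf t x) xs))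
           (skolem j (C t) (map (\<lambda>x. Y t ! leaf t x) xs)) (Y t ! leaf t x))"
    using fusion[of skolem] by (elim exE conjE) (rule that)
  define V :: "nat \<Rightarrow> branch sk \<Rightarrow> nat" where "V = (\<lambda>t. ev (base (C t)) (\<lambda>x. Y t ! leaf t x))"
  have V: "\<exists>i. \<forall>t. V t \<tau> = skolem i (C t) (map (\<lambda>x. Y t ! leaf t x) xs)" if sub: "set_sk \<tau> \<subseteq> set xs" for \<tau> xs
  proof -
    obtain i where i: "\<forall>c f. skolem i c (map f xs) = ev (base c) f \<tau>" using skolem_ex[OF sub] by blast
    show ?thesis unfolding V_def by (intro exI[of _ i] allI i[rule_format, symmetric])
  qed
  have sup: "\<exists>xs. set xs = set_sk \<tau>" for \<tau> :: "branch sk"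
    using finite_set_sk finite_list by blast
  interpret tower C Y V
  proof
    show "V = (\<lambda>t. ev (base (C t)) (\<lambda>x. Y t ! leaf t x))" unfolding V_def ..
  next
    fix t show "t \<le> bnd (C t)" using bnd by blast
  next
    fix k :: nat and \<tau> :: "branch sk" assume "0 < k"
    obtain xs where "set xs = set_sk \<tau>" using sup by blast
    then obtain i where "\<forall>t. V t \<tau> = skolem i (C t) (map (\<lambda>x. Y t ! leaf t x) xs)" using V by blast
    then show "\<exists>v. \<forall>\<^sub>F t in sequentially. V t \<tau> mod k = v" using res[rule_format, OF \<open>0 < k\<close>, of i xs] by simp
  next
    fix \<tau> :: "branch sk"
    obtain xs where "set xs = set_sk \<tau>" using sup by blast
    then obtain i where "\<forall>t. V t \<tau> = skolem i (C t) (map (\<lambda>x. Y t ! leaf t x) xs)" using V by blast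
    then show "\<exists>k0. \<forall>k\<ge>k0. \<exists>s0. \<forall>s\<ge>s0. \<forall>\<^sub>F t in sequentially. V t \<tau> mod k \<in> slalom (C t) k s"
      using cap[rule_format, of i xs] by simp
  next
    fix x :: branch and \<sigma> \<tau> :: "branch sk" assume x: "x \<notin> set_sk \<sigma>" "x \<notin> set_sk \<tau>"
    obtain xs1 xs2 where xs: "set xs1 = set_sk \<sigma>" "set xs2 = set_sk \<tau>" using sup by meson
    \<comment> \<open>The escape clause of \<open>fusion\<close> uses one argument list for both
      functions, so the two supports are joined.\<close>
    have "set_sk \<sigma> \<subseteq> set (xs1 @ xs2)" "set_sk \<tau> \<subseteq> set (xs1 @ xs2)" "x \<notin> set (xs1 @ xs2)"
      using xs x by auto
    moreover obtain i where "\<forall>t. V t \<sigma> = skolem i (C t) (map (\<lambda>x. Y t ! leaf t x) (xs1 @ xs2))"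
      using V[OF calculation(1)] by blast
    moreover obtain j where "\<forall>t. V t \<tau> = skolem j (C t) (map (\<lambda>x. Y t ! leaf t x) (xs1 @ xs2))"
      using V[OF calculation(2)] by blast
    moreover have "V t (Gen x) = Y t ! leaf t x" for t by (simp add: V_def)
    ultimately show "\<exists>m. \<forall>\<^sub>F t in sequentially. \<not> caught (C t) m (V t \<sigma>) (V t \<tau>) (V t (Gen x))"
      using av[rule_format, of x "xs1 @ xs2" i j] by (simp del: map_append)
  qed
  show ?thesis using tower_model by blast
qed

end
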